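(* Any simple element in $\Lambda^\sigma_I\mathrm{GL}(3,\mathbb{C})$ is either $A\,g_{\alpha,\ell}(\lambda)$ (rank 1 type, $\mathrm{rank}(R)=1$) or $A\,m_{\alpha,\ell}(\lambda)$ (rank 2 type, $\mathrm{rank}(R)=2$), where $A=\mathrm{diag}(d,d^{-1},\pm1)$ with $d\in\mathbb{C}^\times$ and $\ell=\mathbb{C}\cdot(b,c,1)$ is a line with $2bc\neq1$. They have the following properties: (1) the determinant is $\left[\dfrac{\lambda^3+\alpha^3}{\lambda^3-\alpha^3}\right]^{\mathrm{rank}(R)}$, independent of $\ell$; (2) $A\,m_{\alpha,\ell}(\lambda)=\dfrac{\lambda^3+\alpha^3}{\lambda^3-\alpha^3}\,A\,g_{\alpha,\ell}(-\lambda)$; (3) $A\,g_{\alpha,\ell}(\lambda)=g_{\alpha,\ell A^{-1}}(\lambda)\,A$.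
   Context: Put $\epsilon=e^{\pi i/3}$, $Q=\mathrm{diag}(\epsilon^4,\epsilon^2,1)$ and $$P=\begin{pmatrix}0&\epsilon^4&0\\ \epsilon^2&0&0\\0&0&1\end{pmatrix}.$$ For sufficiently small $0<r<1$ let $I=\{|\lambda|<r\}\cup\{\lambda\in\mathbb{C}\cup\{\infty\}:|\lambda|>1/r\}$. $\Lambda_I^\sigma\mathrm{GL}(3,\mathbb{C})$ is the group of holomorphic maps $g:I\to\mathrm{GL}(3,\mathbb{C})$ with $\sigma(g(\lambda))=g(\epsilon\lambda)$, where $\sigma(g)=P(g^t)^{-1}P^{-1}$. A simple element is a (nonconstant) rational element with the least number of simple poles. Here it has three simple poles $\alpha,\epsilon^2\alpha,\epsilon^4\alpha$ with $r<|\alpha|<1/r$, and takes the form $$g(\lambda)=A\Big(\mathrm{Id}+\frac{R}{\lambda-\alpha}+\frac{\epsilon^2Q^{-1}RQ}{\lambda-\epsilon^2\alpha}+\frac{\epsilon^4QRQ^{-1}}{\lambda-\epsilon^4\alpha}\Big)$$ with $A$ diagonal and $\mathrm{Id}$ the identity matrix; $R$ in the claim is the matrix in this formula. For $\alpha\in\mathbb{C}^\times$ and a line $\ell=\mathbb{C}\cdot(b,c,1)$ of row vectors with $2bc\ne1$, define $$g_{\alpha,\ell}(\lambda)=\mathrm{Id}+\frac{2}{\lambda^3-\alpha^3}\begin{pmatrix}\frac{\alpha^3bc}{2bc-1}&\frac{\alpha\lambda^2c^2}{2bc-1}&\frac{\alpha^2\lambda c}{2bc-1}\\ \alpha^2\lambda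 b^2&\alpha^3bc&\alpha\lambda^2b\\ \alpha\lambda^2b&\alpha^2\lambda c&\alpha^3\end{pmatrix},$$ $$m_{\alpha,\ell}(\lambda)=\mathrm{Id}+\frac{2}{\lambda^3-\alpha^3}\begin{pmatrix}\frac{\alpha^3(bc-1)}{2bc-1}&\frac{-\alpha\lambda^2c^2}{2bc-1}&\frac{\alpha^2\lambda c}{2bc-1}\\ \alpha^2\lambda b^2&\alpha^3(1-bc)&-\alpha\lambda^2b\\ -\alpha\lambda^2b&\alpha^2\lambda c&0\end{pmatrix}.$$ $\ell A^{-1}$ is the line $\{vA^{-1}:v\in\ell\}$.
   Formalization: With F=(λ³+α³)/(λ³−α³), the scalar-type elements A·F (rank(R)=3) are also simple, so they are listed as a third type; and in (1) the determinant is ±F^{rank(R)}, with the sign of the last entry ±1 of A, since det A=±1. *)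

theory Defs
  imports "HOL-Complex_Analysis.Complex_Analysis"
    "HOL-Computational_Algebra.Polynomial_Factorial"
begin

type_synonym mat3 = "complex ^ 3 ^ 3"

definition eps :: complex where
  "eps = exp (\<i> * of_real pi / 3)"

definition mat3_of :: "complex list list \<Rightarrow> mat3" where
  "mat3_of rs = vector (map vector rs)"

definition diag3 :: "complex \<Rightarrow> complex \<Rightarrow> complex \<Rightarrow> mat3" where
  "diag3 a b c = mat3_of [[a, 0, 0], [0, b, 0], [0, 0, c]]"

definition is_diagonal :: "mat3 \<Rightarrow> bool" where
  "is_diagonal A \<longleftrightarrow> (\<forall>i j. i \<noteq> j \<longrightarrow> A $ i $ j = 0)"

text \<open>The library's \<^const>\<open>scaleR\<close> only scales by real numbers.\<close>

definition cscale :: "complex \<Rightarrow> mat3 \<Rightarrow> mat3" (infixr "*\<^sub>M" 75) where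
  "c *\<^sub>M A = (\<chi> i j. c * A $ i $ j)"

definition Qmat :: mat3 where
  "Qmat = diag3 (eps ^ 4) (eps ^ 2) 1"

definition Pmat :: mat3 where
  "Pmat = mat3_of [[0, eps ^ 4, 0], [eps ^ 2, 0, 0], [0, 0, 1]]"

definition sigma :: "mat3 \<Rightarrow> mat3" where
  "sigma g = Pmat ** matrix_inv (transpose g) ** matrix_inv Pmat"

section \<open>The twisted loop group\<close>

text \<open>The finite part of the domain \<open>I\<close>; the point at infinity is treated through
  the chart \<open>w = 1/z\<close>.\<close>

definition I_dom :: "real \<Rightarrow> complex set" where
  "I_dom r = {z. cmod z < r} \<union> {z. cmod z > 1 / r}"

definition matrix_holomorphic_on :: "(complex \<Rightarrow> mat3) \<Rightarrow> complex set \<Rightarrow> bool" where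
  "matrix_holomorphic_on g S \<longleftrightarrow> (\<forall>i j. (\<lambda>z. g z $ i $ j) holomorphic_on S)"

text \<open>Elements are represented by functions on \<open>\<complex>\<close>, of which only the values on \<^term>\<open>I_dom r\<close>
  are constrained; \<open>L\<close> is the value at infinity, a fixed point of \<open>z \<mapsto> \<epsilon>z\<close>.\<close>

definition loop_group :: "real \<Rightarrow> (complex \<Rightarrow> mat3) set" where
  "loop_group r = {g.
     matrix_holomorphic_on g (I_dom r) \<and>
     (\<forall>z \<in> I_dom r. invertible (g z)) \<and>
     (\<forall>z \<in> I_dom r. sigma (g z) = g (eps * z)) \<and>
     (\<exists>L. matrix_holomorphic_on (\<lambda>w. if w = 0 then L else g (1 / w)) (ball 0 r) \<and>
          invertible L \<and> sigma L = L)}"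

section \<open>Simple elements\<close>

text \<open>Fractions are in lowest terms, so the values are prescribed everywhere
  except at the poles of the respective entry.\<close>

definition rational_matrix :: "(complex \<Rightarrow> mat3) \<Rightarrow> bool" where
  "rational_matrix g \<longleftrightarrow> (\<forall>i j. \<exists>p q :: complex poly. q \<noteq> 0 \<and> coprime p q \<and>
     (\<forall>z. poly q z \<noteq> 0 \<longrightarrow> g z $ i $ j = poly p z / poly q z))"

definition poles :: "(complex \<Rightarrow> mat3) \<Rightarrow> complex set" where
  "poles g = {a. \<exists>i j. is_pole (\<lambda>z. g z $ i $ j) a}"

definition only_simple_poles :: "(complex \<Rightarrow> mat3) \<Rightarrow> bool" where
  "only_simple_poles g \<longleftrightarrow>
     (\<forall>a i j. is_pole (\<lambda>z. g z $ i $ j) a \<longrightarrow> zorder (\<lambda>z. g z $ i $ j) a = -1)"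

text \<open>A member of the loop group has no pole at infinity, so \<^term>\<open>poles\<close> counts
  all poles on the sphere.\<close>

definition candidate_elements :: "real \<Rightarrow> (complex \<Rightarrow> mat3) set" where
  "candidate_elements r = {g \<in> loop_group r. rational_matrix g \<and> only_simple_poles g \<and>
     \<not> (\<exists>C. \<forall>z \<in> I_dom r. g z = C)}"

definition simple_element :: "real \<Rightarrow> (complex \<Rightarrow> mat3) \<Rightarrow> bool" where
  "simple_element r g \<longleftrightarrow> g \<in> candidate_elements r \<and>
     (\<forall>h \<in> candidate_elements r. card (poles g) \<le> card (poles h))"

definition has_simple_form :: "(complex \<Rightarrow> mat3) \<Rightarrow> complex \<Rightarrow> mat3 \<Rightarrow> mat3 \<Rightarrow> bool" where
  "has_simple_form g \<alpha> A R \<longleftrightarrow> is_diagonal A \<and>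
     (\<forall>z. z \<notin> {\<alpha>, eps ^ 2 * \<alpha>, eps ^ 4 * \<alpha>} \<longrightarrow>
        g z = A ** (mat 1
          + (1 / (z - \<alpha>)) *\<^sub>M R
          + (eps ^ 2 / (z - eps ^ 2 * \<alpha>)) *\<^sub>M (matrix_inv Qmat ** R ** Qmat)
          + (eps ^ 4 / (z - eps ^ 4 * \<alpha>)) *\<^sub>M (Qmat ** R ** matrix_inv Qmat)))"

section \<open>Lines and the explicit elements\<close>

definition line_of :: "complex \<Rightarrow> complex \<Rightarrow> (complex ^ 3) set" where
  "line_of b c = vec.span {vector [b, c, 1]}"

definition admissible_line :: "(complex ^ 3) set \<Rightarrow> bool" where
  "admissible_line l \<longleftrightarrow> (\<exists>b c. l = line_of b c \<and> 2 * b * c \<noteq> 1)"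

text \<open>The unique representative \<open>(b, c, 1)\<close> of a line of the form \<^term>\<open>line_of b c\<close>.\<close>

definition line_rep :: "(complex ^ 3) set \<Rightarrow> complex ^ 3" where
  "line_rep l = (THE v. v \<in> l \<and> v $ 3 = 1)"

lemma line_rep_line_of [simp]: "line_rep (line_of b c) = vector [b, c, 1]"
  unfolding line_rep_def line_of_def
  by (rule the_equality) (auto simp: vec.span_base, auto simp: vec.span_singleton)

definition line_times :: "(complex ^ 3) set \<Rightarrow> mat3 \<Rightarrow> (complex ^ 3) set" where
  "line_times l M = (\<lambda>v. v v* M) ` l"

definition g_elt :: "complex \<Rightarrow> (complex ^ 3) set \<Rightarrow> complex \<Rightarrow> mat3" where
  "g_elt \<alpha> l z = (let b = line_rep l $ 1; c = line_rep l $ 2; D = 2 * b * c - 1 in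
     mat 1 + (2 / (z ^ 3 - \<alpha> ^ 3)) *\<^sub>M mat3_of
       [[\<alpha> ^ 3 * b * c / D,    \<alpha> * z ^ 2 * c ^ 2 / D, \<alpha> ^ 2 * z * c / D],
        [\<alpha> ^ 2 * z * b ^ 2,    \<alpha> ^ 3 * b * c,         \<alpha> * z ^ 2 * b],
        [\<alpha> * z ^ 2 * b,        \<alpha> ^ 2 * z * c,         \<alpha> ^ 3]])"

definition m_elt :: "complex \<Rightarrow> (complex ^ 3) set \<Rightarrow> complex \<Rightarrow> mat3" where
  "m_elt \<alpha> l z = (let b = line_rep l $ 1; c = line_rep l $ 2; D = 2 * b * c - 1 in
     mat 1 + (2 / (z ^ 3 - \<alpha> ^ 3)) *\<^sub>M mat3_of
       [[\<alpha> ^ 3 * (b * c - 1) / D, - (\<alpha> * z ^ 2 * c ^ 2) / D, \<alpha> ^ 2 * z * c / D],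
        [\<alpha> ^ 2 * z * b ^ 2,       \<alpha> ^ 3 * (1 - b * c),       - (\<alpha> * z ^ 2 * b)],
        [- (\<alpha> * z ^ 2 * b),       \<alpha> ^ 2 * z * c,             0]])"

text \<open>Since \<open>\<epsilon>\<^sup>3 = -1\<close>, \<open>ratio \<alpha> (\<epsilon>z) = 1 / ratio \<alpha> z\<close>; hence the scalar matrix \<open>ratio \<alpha>\<close> is
  itself a simple element, with residue matrix \<open>(2\<alpha>/3) Id\<close> of rank 3.\<close>

definition ratio :: "complex \<Rightarrow> complex \<Rightarrow> complex" where
  "ratio \<alpha> z = (z ^ 3 + \<alpha> ^ 3) / (z ^ 3 - \<alpha> ^ 3)"

end

theory Submission
  imports Defs
begin

text \<open>The pole set of an element of the twisted loop group is invariant under \<open>\<lambda> \<mapsto> \<epsilon>\<^sup>2\<lambda>\<close> and does not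
  contain 0, and the scalar element \<open>(\<lambda>\<^sup>3 + 1)/(\<lambda>\<^sup>3 - 1)\<close> has three poles, so the poles of a simple
  element form one orbit. Liouville's theorem turns a matrix function with
  these simple poles into a sum of principal parts, and the rotation symmetry ties the three residues
  together. The full twist says \<open>g(\<epsilon>\<lambda>) P g(\<lambda>)\<^sup>T = P\<close>; the
  poles of the two factors are disjoint, so it amounts to the vanishing of one residue. With
  \<open>R = (2\<alpha>/3) M\<close> this is a quadratic matrix equation for \<open>M\<close>, whose nonzero solutions are the identity,
  a family of rank 1 and a family of rank 2.\<close>

text \<open>While \<open>$\<close> also denotes coefficients of formal power series, the number of parses of a
  matrix of entries \<open>M $ i $ j\<close> grows exponentially.\<close>

no_notation fps_nth (infixl "$" 75)

section \<open>Matrices and the twist\<close>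

text \<open>The twist has order 6. Its square is conjugation by Q and ties \<lambda> to \<epsilon>^2
  \<lambda>; this makes the sum over an orbit of poles a finite Fourier transform, so that every
  entry becomes one monomial over \<lambda>^3 - \<alpha>^3. What constrains the residue is the
  remaining half, which ties \<lambda> to \<epsilon> \<lambda>. As \<epsilon>^3 = -1, it turns the
  denominator into -(\<lambda>^3 + \<alpha>^3); clearing both denominators makes the twist a
  polynomial identity, and its residue at \<alpha> is obtained by evaluation. Two obstacles shape
  the rest. The twist is given only on I, which contains no pole, so the identity theorem has to
  carry it to the poles. And the classification concerns every \<alpha>, A and R that represent g in
  the simple form, not only those built from its poles, so the degenerate data \<alpha> = 0 and R =
  0 have to be excluded.\<close>

lemma eps_square: "eps ^ 2 = eps - 1"
proof -
  have "eps = Complex (1/2) (sqrt 3 / 2)"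
    unfolding eps_def
    by (rule complex_eqI) (simp_all add: Re_exp Im_exp cos_60 sin_60)
  hence "eps ^ 2 = Complex (1/2) (sqrt 3 / 2) ^ 2" "eps - 1 = Complex (1/2) (sqrt 3 / 2) - 1"
    by simp_all
  thus ?thesis
    by (simp add: power2_eq_square complex_eq_iff)
qed

lemma eps_power:
  "eps * eps = eps - 1" "eps ^ 3 = -1" "eps ^ 4 = - eps"
  using eps_square by algebra+

text \<open>Reduces powers of \<open>eps\<close> inside right-nested products too, so that
  identities between polynomials in \<open>eps\<close> can be settled by rewriting.\<close>

lemma eps_mult_left: "eps * (eps * x) = eps * x - x"
  by (simp flip: mult.assoc add: eps_power(1) left_diff_distrib)

lemma eps_nonzero [simp]: "eps \<noteq> 0"
  by (simp add: eps_def)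

section \<open>Entrywise calculus for 3 x 3 matrices\<close>

lemma mat3_of_component [simp]:
  "mat3_of [[a,b,c],[d,e,f],[p,q,s]] $ 1 $ 1 = a" "mat3_of [[a,b,c],[d,e,f],[p,q,s]] $ 1 $ 2 = b"
  "mat3_of [[a,b,c],[d,e,f],[p,q,s]] $ 1 $ 3 = c" "mat3_of [[a,b,c],[d,e,f],[p,q,s]] $ 2 $ 1 = d"
  "mat3_of [[a,b,c],[d,e,f],[p,q,s]] $ 2 $ 2 = e" "mat3_of [[a,b,c],[d,e,f],[p,q,s]] $ 2 $ 3 = f"
  "mat3_of [[a,b,c],[d,e,f],[p,q,s]] $ 3 $ 1 = p" "mat3_of [[a,b,c],[d,e,f],[p,q,s]] $ 3 $ 2 = q"
  "mat3_of [[a,b,c],[d,e,f],[p,q,s]] $ 3 $ 3 = s"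
  by (simp_all add: mat3_of_def vector_3)

lemma mat3_eqI:
  fixes X Y :: mat3
  assumes "X$1$1 = Y$1$1" "X$1$2 = Y$1$2" "X$1$3 = Y$1$3"
    "X$2$1 = Y$2$1" "X$2$2 = Y$2$2" "X$2$3 = Y$2$3"
    "X$3$1 = Y$3$1" "X$3$2 = Y$3$2" "X$3$3 = Y$3$3"
  shows "X = Y"
  using assms by (simp add: vec_eq_iff forall_3)

lemma diag3_component [simp]:
  "diag3 a b c $ 1 $ 1 = a" "diag3 a b c $ 1 $ 2 = 0" "diag3 a b c $ 1 $ 3 = 0"
  "diag3 a b c $ 2 $ 1 = 0" "diag3 a b c $ 2 $ 2 = b" "diag3 a b c $ 2 $ 3 = 0"
  "diag3 a b c $ 3 $ 1 = 0" "diag3 a b c $ 3 $ 2 = 0" "diag3 a b c $ 3 $ 3 = c"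
  by (simp_all add: diag3_def)

lemma matrix_mult3:
  fixes X Y :: mat3
  shows "(X ** Y) $ i $ j = X$i$1 * Y$1$j + X$i$2 * Y$2$j + X$i$3 * Y$3$j"
  by (simp add: matrix_matrix_mult_def sum_3)

lemma mat_component: "(mat c :: mat3) $ i $ j = (if i = j then c else 0)"
  by (simp add: mat_def)

lemma cscale_component [simp]: "(c *\<^sub>M X) $ i $ j = c * X $ i $ j"
  by (simp add: cscale_def)

lemma transpose_component [simp]: "transpose X $ i $ j = X $ j $ i"
  by (simp add: transpose_def)

lemma diag3_mult_component:
  "(diag3 a b c ** X) $ 1 $ j = a * X $ 1 $ j"
  "(diag3 a b c ** X) $ 2 $ j = b * X $ 2 $ j"
  "(diag3 a b c ** X) $ 3 $ j = c * X $ 3 $ j"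
  "(X ** diag3 a b c) $ i $ 1 = X $ i $ 1 * a"
  "(X ** diag3 a b c) $ i $ 2 = X $ i $ 2 * b"
  "(X ** diag3 a b c) $ i $ 3 = X $ i $ 3 * c"
  by (simp_all add: matrix_mult3)

lemma matrix_inv_works:
  fixes X :: "'a::semiring_1^'n^'m"
  assumes "invertible X"
  shows "X ** matrix_inv X = mat 1" "matrix_inv X ** X = mat 1"
  using someI_ex[OF assms[unfolded invertible_def]] by (auto simp: matrix_inv_def)

lemma matrix_inv_eqI:
  fixes X :: "'a::field^'n^'n"
  assumes "X ** Y = mat 1"
  shows "matrix_inv X = Y"
proof -
  have "invertible X" using assms by (auto simp: invertible_def matrix_left_right_inverse)
  thus ?thesis
    by (metis assms matrix_inv_works(2) matrix_mul_assoc matrix_mul_lid matrix_mul_rid)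
qed

lemma matrix_inv_diag3:
  assumes "a \<noteq> 0" "b \<noteq> 0" "c \<noteq> 0"
  shows "matrix_inv (diag3 a b c) = diag3 (inverse a) (inverse b) (inverse c)"
  by (rule matrix_inv_eqI, rule mat3_eqI)
     (use assms in \<open>simp_all add: diag3_mult_component mat_component\<close>)

section \<open>The twist in a form without inverses\<close>

lemma Pmat_involution: "Pmat ** Pmat = mat 1"
  by (rule mat3_eqI)
     (simp_all add: Pmat_def matrix_mult3 mat_component eps_power eps_square algebra_simps)

lemma Pmat_transpose_involution: "transpose Pmat ** transpose Pmat = mat 1"
  by (simp flip: matrix_transpose_mul add: Pmat_involution)

lemma matrix_inv_Pmat: "matrix_inv Pmat = Pmat"
  by (rule matrix_inv_eqI) (rule Pmat_involution)

text \<open>Multiplication by \<open>Pmat ** transpose X\<close> on the right cancels both inverses,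
  since \<open>Pmat\<close> is an involution. The resulting equation is bilinear in the two values,
  which is the form that later arguments use.\<close>

lemma sigma_eq_imp:
  assumes "invertible X" "sigma X = Y"
  shows "Y ** Pmat ** transpose X = Pmat"
proof -
  have inv: "matrix_inv (transpose X) ** transpose X = mat 1"
    using assms(1) by (metis invertible_def matrix_inv_works(2) matrix_transpose_mul transpose_mat)
  have "Y ** Pmat ** transpose X
      = Pmat ** matrix_inv (transpose X) ** (Pmat ** Pmat) ** transpose X"
    using assms(2) unfolding sigma_def matrix_inv_Pmat by (simp add: matrix_mul_assoc)
  also have "\<dots> = Pmat ** (matrix_inv (transpose X) ** transpose X)"
    by (simp add: Pmat_involution matrix_mul_assoc)
  finally show ?thesis by (simp add: inv)
qed

text \<open>The equation itself exhibits \<open>Pmat ** Y ** Pmat\<close> as a left inverse of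
  \<open>transpose X\<close>, and for square matrices a left inverse is two-sided.\<close>

lemma sigma_eqI:
  assumes "Y ** Pmat ** transpose X = Pmat"
  shows "sigma X = Y"
proof -
  have 1: "(Pmat ** Y ** Pmat) ** transpose X = mat 1"
    using assms Pmat_involution by (metis matrix_mul_assoc)
  hence "matrix_inv (transpose X) = Pmat ** Y ** Pmat"
    by (intro matrix_inv_eqI) (simp add: matrix_left_right_inverse)
  thus ?thesis
    unfolding sigma_def matrix_inv_Pmat
    by (metis Pmat_involution matrix_mul_assoc matrix_mul_lid matrix_mul_rid)
qed

text \<open>Two inverse transpositions cancel. What remains is multiplication by
  \<open>Pmat ** transpose Pmat\<close>, the inverse of Q, on the left and by
  \<open>transpose Pmat ** Pmat\<close>, which is Q, on the right.\<close>

lemma sigma_twice: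
  assumes "Y ** Pmat ** transpose X = Pmat" "Z ** Pmat ** transpose Y = Pmat"
  shows "Z = diag3 (eps ^ 2) (eps ^ 4) 1 ** X ** Qmat"
proof -
  let ?Pt = "transpose Pmat"
  have "transpose (Y ** Pmat ** transpose X) = ?Pt" using assms(1) by simp
  hence "X ** ?Pt ** transpose Y = ?Pt"
    by (simp add: matrix_transpose_mul matrix_mul_assoc)
  hence "(?Pt ** X ** ?Pt) ** transpose Y = mat 1"
    using Pmat_transpose_involution by (metis matrix_mul_assoc)
  hence "transpose Y ** (?Pt ** X ** ?Pt) = mat 1"
    by (simp add: matrix_left_right_inverse)
  hence "Z ** Pmat = Pmat ** (?Pt ** X ** ?Pt)"
    using assms(2) by (metis matrix_mul_assoc matrix_mul_rid)
  hence "Z = (Pmat ** ?Pt) ** X ** (?Pt ** Pmat)"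
    using Pmat_involution by (metis matrix_mul_assoc matrix_mul_rid)
  moreover have "Pmat ** ?Pt = diag3 (eps ^ 2) (eps ^ 4) 1"
    by (rule mat3_eqI) (simp_all add: Pmat_def matrix_mult3 eps_power eps_square algebra_simps)
  moreover have "?Pt ** Pmat = Qmat"
    by (rule mat3_eqI) (simp_all add: Pmat_def Qmat_def matrix_mult3 eps_power eps_square algebra_simps)
  ultimately show ?thesis by simp
qed

lemma matrix_inv_Qmat: "matrix_inv Qmat = diag3 (eps ^ 2) (eps ^ 4) 1"
proof -
  have "inverse (eps^4) = eps^2" "inverse (eps^2) = eps^4"
    by (rule inverse_unique, simp add: eps_power eps_square algebra_simps)+
  thus ?thesis by (simp add: Qmat_def matrix_inv_diag3)
qed

text \<open>For u^3 = 1 the fraction 1 / (z - u \<alpha>) is (z^2 + z u \<alpha> + u^2 \<alpha>^2) /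
  (z^3 - \<alpha>^3). The weights u, 1 and u^2 are the three characters of the cube roots of unity,
  and each sum kills two of the three monomials.\<close>

lemma root_orbit_partial_fractions:
  assumes "z ^ 3 \<noteq> \<alpha> ^ 3"
  shows "1 / (z - \<alpha>) + eps^2 / (z - eps^2 * \<alpha>) + eps^4 / (z - eps^4 * \<alpha>) = 3 * \<alpha>^2 / (z^3 - \<alpha>^3)"
    "1 / (z - \<alpha>) + 1 / (z - eps^2 * \<alpha>) + 1 / (z - eps^4 * \<alpha>) = 3 * z^2 / (z^3 - \<alpha>^3)"
    "1 / (z - \<alpha>) + eps^4 / (z - eps^2 * \<alpha>) + eps^2 / (z - eps^4 * \<alpha>) = 3 * (\<alpha> * z) / (z^3 - \<alpha>^3)"
proof -
  have *: "1 / (z - u * \<alpha>) = (z^2 + z * u * \<alpha> + u^2 * \<alpha>^2) / (z^3 - \<alpha>^3)" if "u ^ 3 = 1" for u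
  proof -
    have "(z - u * \<alpha>) * (z^2 + z * u * \<alpha> + u^2 * \<alpha>^2) = z^3 - \<alpha>^3"
      using that by algebra
    thus ?thesis using assms by (auto simp: divide_simps mult.commute)
  qed
  have e: "(eps^2)^3 = 1" "(eps^4)^3 = 1" using eps_square by algebra+
  have 1: "1 / (z - \<alpha>) = (z^2 + z * \<alpha> + \<alpha>^2) / (z^3 - \<alpha>^3)" using *[of 1] by simp
  have 2: "c / (z - eps^2 * \<alpha>) = c * (z^2 + z * eps^2 * \<alpha> + (eps^2)^2 * \<alpha>^2) / (z^3 - \<alpha>^3)" for c
    using *[OF e(1)] by (metis mult.right_neutral times_divide_eq_right)
  have 3: "c / (z - eps^4 * \<alpha>) = c * (z^2 + z * eps^4 * \<alpha> + (eps^4)^2 * \<alpha>^2) / (z^3 - \<alpha>^3)" for c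
    using *[OF e(2)] by (metis mult.right_neutral times_divide_eq_right)
  show "1 / (z - \<alpha>) + eps^2 / (z - eps^2 * \<alpha>) + eps^4 / (z - eps^4 * \<alpha>) = 3 * \<alpha>^2 / (z^3 - \<alpha>^3)"
    unfolding 1 2 3 add_divide_distrib[symmetric] using eps_square
    by (intro arg_cong2[where f="(/)"] refl) algebra
  show "1 / (z - \<alpha>) + 1 / (z - eps^2 * \<alpha>) + 1 / (z - eps^4 * \<alpha>) = 3 * z^2 / (z^3 - \<alpha>^3)"
    unfolding 1 2 3 add_divide_distrib[symmetric] using eps_square
    by (intro arg_cong2[where f="(/)"] refl) algebra
  show "1 / (z - \<alpha>) + eps^4 / (z - eps^2 * \<alpha>) + eps^2 / (z - eps^4 * \<alpha>) = 3 * (\<alpha> * z) / (z^3 - \<alpha>^3)"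
    unfolding 1 2 3 add_divide_distrib[symmetric] using eps_square
    by (intro arg_cong2[where f="(/)"] refl) algebra
qed

section \<open>Classification of the residue matrices\<close>

lemma proportional3:
  fixes n1 n2 n3 x1 x2 x3 :: "'a::field"
  assumes "x1 * n2 = x2 * n1" "x1 * n3 = x3 * n1" "x2 * n3 = x3 * n2"
    and "n1 \<noteq> 0 \<or> n2 \<noteq> 0 \<or> n3 \<noteq> 0"
  shows "\<exists>k. x1 = k * n1 \<and> x2 = k * n2 \<and> x3 = k * n3"
  using assms(4)
proof (elim disjE)
  assume "n1 \<noteq> 0"
  thus ?thesis using assms(1-3) by (intro exI[of _ "x1 / n1"]) (simp add: field_simps)
next
  assume "n2 \<noteq> 0"
  thus ?thesis using assms(1-3) by (intro exI[of _ "x2 / n2"]) (simp add: field_simps)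
next
  assume "n3 \<noteq> 0"
  thus ?thesis using assms(1-3) by (intro exI[of _ "x3 / n3"]) (simp add: field_simps)
qed

text \<open>Here v is the cross product of s and t. The identity x \<times> (s \<times> t) = s (x .
  t) - t (x . s) shows that x is parallel to it.\<close>

lemma orthogonal_to_two:
  fixes s1 s2 s3 t1 t2 t3 x1 x2 x3 :: "'a::field"
  defines "v1 \<equiv> s2 * t3 - s3 * t2" and "v2 \<equiv> s3 * t1 - s1 * t3" and "v3 \<equiv> s1 * t2 - s2 * t1"
  assumes "x1 * s1 + x2 * s2 + x3 * s3 = 0" "x1 * t1 + x2 * t2 + x3 * t3 = 0"
    and "v1 \<noteq> 0 \<or> v2 \<noteq> 0 \<or> v3 \<noteq> 0"
  shows "\<exists>k. x1 = k * v1 \<and> x2 = k * v2 \<and> x3 = k * v3"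
proof (rule proportional3)
  let ?s = "x1 * s1 + x2 * s2 + x3 * s3" and ?t = "x1 * t1 + x2 * t2 + x3 * t3"
  have "x1 * v2 - x2 * v1 = s3 * ?t - t3 * ?s" "x1 * v3 - x3 * v1 = t2 * ?s - s2 * ?t"
    "x2 * v3 - x3 * v2 = s1 * ?t - t1 * ?s"
    unfolding v1_def v2_def v3_def by (simp_all add: algebra_simps)
  thus "x1 * v2 = x2 * v1" "x1 * v3 = x3 * v1" "x2 * v3 = x3 * v2"
    by (simp_all only: assms(4,5) mult_zero_right diff_0_right right_minus_eq)
qed fact

text \<open>The column (c/D, b, 1) times the row (b, c, 1) that spans the line.\<close>

definition g_residue :: "complex \<Rightarrow> complex \<Rightarrow> mat3" where
  "g_residue b c = (let D = 2 * b * c - 1 in mat3_of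
     [[b * c / D, c ^ 2 / D, c / D],
      [b ^ 2, b * c, b],
      [b, c, 1]])"

text \<open>This matrix annihilates the column (c, b, 1), the row of the line with its first two
  entries exchanged. Its diagonal is that of the identity minus that of \<open>g_residue b c\<close>
  when D is nonzero.\<close>

definition m_residue :: "complex \<Rightarrow> complex \<Rightarrow> mat3" where
  "m_residue b c = (let D = 2 * b * c - 1 in mat3_of
     [[(b * c - 1) / D, - (c ^ 2) / D, c / D],
      [b ^ 2, 1 - b * c, - b],
      [- b, c, 0]])"

text \<open>The entries are chosen such that \<open>M T\<^sup>T = 0\<close> says that the residue of
  \<open>g(\<epsilon>\<lambda>) P g(\<lambda>)\<^sup>T\<close> at \<open>\<alpha>\<close> vanishes (lemma \<open>residue_condition\<close>).\<close>

definition residue_defect :: "mat3 \<Rightarrow> mat3" where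
  "residue_defect M = mat3_of
     [[- M$1$2, 1 - M$1$1, M$1$3],
      [1 - M$2$2, M$2$1, - M$2$3],
      [M$3$2, - M$3$1, 1 - M$3$3]]"

text \<open>The rows of the defect span a subspace of the kernel of \<open>M\<close>: if two of them are independent,
  then \<open>M\<close> has rank 1; otherwise the defect is \<open>w n\<^sup>T\<close> with \<open>M n = 0\<close>, and this determines \<open>M\<close>.\<close>

lemma residue_classification:
  assumes eq: "M ** transpose (residue_defect M) = 0" and "M \<noteq> 0"
  shows "M = mat 1 \<or> (\<exists>b c. 2 * b * c \<noteq> 1 \<and> (M = g_residue b c \<or> M = m_residue b c))"
proof -
  define T where "T = residue_defect M"
  have ker: "M$i$1 * T$j$1 + M$i$2 * T$j$2 + M$i$3 * T$j$3 = 0" for i j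
    using arg_cong[OF eq, of "\<lambda>X. X $ i $ j"] by (simp add: matrix_mult3 T_def)
  have T: "T$1$1 = - M$1$2" "T$1$2 = 1 - M$1$1" "T$1$3 = M$1$3"
    "T$2$1 = 1 - M$2$2" "T$2$2 = M$2$1" "T$2$3 = - M$2$3"
    "T$3$1 = M$3$2" "T$3$2 = - M$3$1" "T$3$3 = 1 - M$3$3"
    by (simp_all add: T_def residue_defect_def)
  consider (zero) "T = 0"
    | (rank1) i j where "T$i$2 * T$j$3 - T$i$3 * T$j$2 \<noteq> 0 \<or> T$i$3 * T$j$1 - T$i$1 * T$j$3 \<noteq> 0
         \<or> T$i$1 * T$j$2 - T$i$2 * T$j$1 \<noteq> 0"
    | (rank2) w n where "n \<noteq> 0" "\<And>i k. T$i$k = w i * n$k"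
         "\<And>i. M$i$1 * n$1 + M$i$2 * n$2 + M$i$3 * n$3 = 0"
  proof (cases "\<exists>i j. T$i$2 * T$j$3 - T$i$3 * T$j$2 \<noteq> 0 \<or> T$i$3 * T$j$1 - T$i$1 * T$j$3 \<noteq> 0
         \<or> T$i$1 * T$j$2 - T$i$2 * T$j$1 \<noteq> 0")
    case True
    then obtain i j where "T$i$2 * T$j$3 - T$i$3 * T$j$2 \<noteq> 0 \<or> T$i$3 * T$j$1 - T$i$1 * T$j$3 \<noteq> 0
         \<or> T$i$1 * T$j$2 - T$i$2 * T$j$1 \<noteq> 0"
      by (elim exE)
    thus ?thesis by (rule that(2))
  next
    case False
    show ?thesis
    proof (cases "T = 0")
      case True
      thus ?thesis by (rule that(1))
    next
      case T0: False
      then obtain l where l: "T $ l \<noteq> 0" by (metis vec_eq_iff zero_index)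
      hence l': "T$l$1 \<noteq> 0 \<or> T$l$2 \<noteq> 0 \<or> T$l$3 \<noteq> 0" by (simp add: vec_eq_iff forall_3)
      have "\<exists>k. T$i$1 = k * T$l$1 \<and> T$i$2 = k * T$l$2 \<and> T$i$3 = k * T$l$3" for i
      proof (rule proportional3)
        show "T$i$1 * T$l$2 = T$i$2 * T$l$1" "T$i$1 * T$l$3 = T$i$3 * T$l$1" "T$i$2 * T$l$3 = T$i$3 * T$l$2"
          using spec[OF spec[OF False[unfolded not_ex], of i], of l]
          unfolding de_Morgan_disj not_not right_minus_eq by (simp_all only: mult.commute)
      qed (rule l')
      hence "\<forall>i. \<exists>k. T$i$1 = k * T$l$1 \<and> T$i$2 = k * T$l$2 \<and> T$i$3 = k * T$l$3" ..
      from choice[OF this] obtain w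
        where "\<forall>i. T$i$1 = w i * T$l$1 \<and> T$i$2 = w i * T$l$2 \<and> T$i$3 = w i * T$l$3" ..
      hence w: "T$i$k = w i * T$l$k" for i k
        using exhaust_3[of k] by auto
      show ?thesis by (rule that(3)[OF l w ker])
    qed
  qed
  thus ?thesis
  proof cases
    case zero
    hence "T $ i $ j = 0" for i j by (simp only: zero_index)
    note this[of 1 1] this[of 1 2] this[of 1 3] this[of 2 1] this[of 2 2] this[of 2 3]
      this[of 3 1] this[of 3 2] this[of 3 3]
    hence "M = mat 1"
      unfolding T by (intro mat3_eqI) (simp_all add: mat_component)
    thus ?thesis ..
  next
    case (rank1 i j)
    define v1 v2 v3 where "v1 = T$i$2 * T$j$3 - T$i$3 * T$j$2"
      and "v2 = T$i$3 * T$j$1 - T$i$1 * T$j$3" and "v3 = T$i$1 * T$j$2 - T$i$2 * T$j$1"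
    have v: "v1 \<noteq> 0 \<or> v2 \<noteq> 0 \<or> v3 \<noteq> 0" using rank1 unfolding v1_def v2_def v3_def .
    have "\<exists>k. M$l$1 = k * v1 \<and> M$l$2 = k * v2 \<and> M$l$3 = k * v3" for l
      unfolding v1_def v2_def v3_def by (rule orthogonal_to_two[OF ker ker rank1])
    hence "\<forall>l. \<exists>k. M$l$1 = k * v1 \<and> M$l$2 = k * v2 \<and> M$l$3 = k * v3" ..
    from choice[OF this] obtain u
      where "\<forall>l. M$l$1 = u l * v1 \<and> M$l$2 = u l * v2 \<and> M$l$3 = u l * v3" ..
    hence u: "M$l$1 = u l * v1" "M$l$2 = u l * v2" "M$l$3 = u l * v3" for l
      by simp_all
    obtain l where l: "u l \<noteq> 0"
    proof (rule ccontr)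
      assume "\<not> thesis"
      hence "u l = 0" for l using that by blast
      hence "M = 0" by (intro mat3_eqI) (simp_all add: u)
      with \<open>M \<noteq> 0\<close> show False ..
    qed
    have Tv: "v1 * T$k$1 + v2 * T$k$2 + v3 * T$k$3 = 0" for k
    proof -
      have "u l * (v1 * T$k$1 + v2 * T$k$2 + v3 * T$k$3) = 0"
        using ker[of l k] by (simp add: u algebra_simps)
      thus ?thesis using l by simp
    qed
    \<comment> \<open>\<open>T\<close> is affine in \<open>M\<close>, so with \<open>M\<close> the
      product of the column u and the row v the equations T v = 0 express v through u. They force
      \<open>v3\<close> to be nonzero, so v can be scaled to (b, c, 1).\<close>
    have e: "v2 = u 1 * (2 * v1 * v2 - v3 ^ 2)" "v1 = u 2 * v3 ^ 2" "v3 = u 3 * v3 ^ 2"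
      using Tv[of 1] Tv[of 2] Tv[of 3]
      by (simp_all add: T u algebra_simps power2_eq_square)
    have v3: "v3 \<noteq> 0"
    proof
      assume "v3 = 0"
      with e have "v1 = 0" "v2 = 0" by simp_all
      with \<open>v3 = 0\<close> v show False by simp
    qed
    define b c where "b = v1 / v3" and "c = v2 / v3"
    have v12: "v1 = b * v3" "v2 = c * v3" using v3 by (simp_all add: b_def c_def)
    have u23: "u 3 * v3 = 1" "u 2 * v3 = b"
      using e(2,3) v3 by (simp_all add: v12 power2_eq_square)
    have "v3 * c = v3 * ((u 1 * v3) * (2 * b * c - 1))"
      using e(1) unfolding v12 by (simp add: power2_eq_square algebra_simps)
    hence u1: "c = (u 1 * v3) * (2 * b * c - 1)"
      using v3 by (simp only: mult_cancel_left simp_thms)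
    \<comment> \<open>If D vanished, \<open>u1\<close> would give c = 0 and thus D = -1.\<close>
    have D: "2 * b * c - 1 \<noteq> 0"
      using u1 by auto
    hence "u 1 * v3 = c / (2 * b * c - 1)" using u1 by (simp add: field_simps)
    hence "M$1$3 = c / (2 * b * c - 1)" "M$2$3 = b" "M$3$3 = 1"
      using u23 by (simp_all add: u)
    moreover have "M$k$1 = M$k$3 * b" "M$k$2 = M$k$3 * c" for k
      by (simp_all add: u v12)
    ultimately have "M = g_residue b c"
      by (intro mat3_eqI) (simp_all add: g_residue_def Let_def power2_eq_square)
    with D show ?thesis by auto
  next
    case (rank2 w n)
    note w = rank2(2) and n = rank2(3)
    \<comment> \<open>Each entry of \<open>M\<close> occurs in exactly one entry of
      \<open>T\<close>, so \<open>M\<close> is recovered from w and n. The condition M n = 0 then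
      repeats the equations of the previous case with the first two coordinates of n in exchanged
      roles; hence the exchanged quotients for b and c.\<close>
    have M: "M$1$2 = - (w 1 * n$1)" "M$1$1 = 1 - w 1 * n$2" "M$1$3 = w 1 * n$3"
      "M$2$2 = 1 - w 2 * n$1" "M$2$1 = w 2 * n$2" "M$2$3 = - (w 2 * n$3)"
      "M$3$2 = w 3 * n$1" "M$3$1 = - (w 3 * n$2)" "M$3$3 = 1 - w 3 * n$3"
      using T unfolding w by (simp_all add: algebra_simps)
    have e: "n$1 = w 1 * (2 * n$1 * n$2 - n$3 ^ 2)" "n$2 = w 2 * n$3 ^ 2" "n$3 = w 3 * n$3 ^ 2"
      using n[of 1] n[of 2] n[of 3]
      by (simp_all add: M algebra_simps power2_eq_square)
    have n3: "n$3 \<noteq> 0"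
    proof
      assume "n$3 = 0"
      with e have "n$2 = 0" "n$1 = 0" by simp_all
      with \<open>n$3 = 0\<close> rank2(1) show False by (simp add: vec_eq_iff forall_3)
    qed
    define b c where "b = n$2 / n$3" and "c = n$1 / n$3"
    have n12: "n$1 = c * n$3" "n$2 = b * n$3" using n3 by (simp_all add: b_def c_def)
    have w23: "w 3 * n$3 = 1" "w 2 * n$3 = b" 
      using e(2,3) n3 by (simp_all add: n12 power2_eq_square)
    have "n$3 * c = n$3 * ((w 1 * n$3) * (2 * b * c - 1))"
      using e(1) unfolding n12 by (simp add: power2_eq_square algebra_simps)
    hence w1: "c = (w 1 * n$3) * (2 * b * c - 1)"
      using n3 by (simp only: mult_cancel_left simp_thms)
    have D: "2 * b * c - 1 \<noteq> 0"
      using w1 by auto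
    hence "w 1 * n$3 = c / (2 * b * c - 1)" using w1 by (simp add: field_simps)
    hence "M = m_residue b c"
      using D w23 by (intro mat3_eqI) (simp_all add: M n12 m_residue_def Let_def field_simps power2_eq_square)
    with D show ?thesis by auto
  qed
qed

section \<open>The explicit elements\<close>

lemma rank_eq_dim_rows3: "rank (X :: 'a::field^'n^3) = vec.dim {X $ 1, X $ 2, X $ 3}"
proof -
  have "rows X = {X $ 1, X $ 2, X $ 3}"
    by (auto simp: rows_def row_def UNIV_3 vec_nth_inverse)
  thus ?thesis by (simp add: row_rank_def_gen)
qed

lemma rank_eq_1:
  fixes X :: "'a::field^'n^3"
  assumes "X $ 3 \<noteq> 0" "X $ 1 = x *s X $ 3" "X $ 2 = y *s X $ 3"
  shows "rank X = 1"
proof -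
  have "X $ 3 \<notin> vec.span {}" using assms(1) by simp
  moreover have "X $ 2 \<in> vec.span {X $ 3}" "X $ 1 \<in> vec.span {X $ 2, X $ 3}"
    unfolding assms(2,3) by (intro vec.span_scale vec.span_base; simp)+
  ultimately show ?thesis
    unfolding rank_eq_dim_rows3 by (simp add: vec.dim_insert)
qed

lemma rank_eq_2:
  fixes X :: "'a::field^'n^3"
  assumes "X $ 1 $ i * X $ 2 $ j \<noteq> X $ 1 $ j * X $ 2 $ i" "X $ 3 = x *s X $ 1 + y *s X $ 2"
  shows "rank X = 2"
proof -
  have "X $ 2 \<notin> vec.span {}" using assms(1) by auto
  moreover have "X $ 1 \<notin> vec.span {X $ 2}"
    using assms(1) by (auto simp: vec.span_singleton)
  moreover have "X $ 3 \<in> vec.span {X $ 1, X $ 2}"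
    unfolding assms(2) by (intro vec.span_add vec.span_scale vec.span_base) auto
  ultimately have "vec.dim {X $ 3, X $ 1, X $ 2} = 2"
    by (simp add: vec.dim_insert)
  thus ?thesis by (simp add: rank_eq_dim_rows3 insert_commute)
qed

lemma rank_eq_full:
  fixes X :: "'a::field^'n^'n"
  assumes "invertible X"
  shows "rank X = CARD('n)"
proof -
  have "vec.span (rows X) = UNIV"
    using assms unfolding matrix_left_invertible_span_rows_gen[symmetric] invertible_def by blast
  hence "vec.dim (rows X) = vec.dim (UNIV :: ('a^'n) set)" by (metis vec.dim_span)
  thus ?thesis by (simp only: row_rank_def_gen vec_dim_card)
qed

text \<open>Conjugation by \<open>Q\<close> multiplies each entry by a cube root of unity, so summing a principal part
  over the orbit of \<open>\<alpha>\<close> leaves a single monomial in every entry.\<close>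

definition residue_numerator :: "complex \<Rightarrow> mat3 \<Rightarrow> complex \<Rightarrow> mat3" where
  "residue_numerator \<alpha> R z = mat3_of
     [[\<alpha>^2 * R$1$1, z^2 * R$1$2, \<alpha> * z * R$1$3],
      [\<alpha> * z * R$2$1, \<alpha>^2 * R$2$2, z^2 * R$2$3],
      [z^2 * R$3$1, \<alpha> * z * R$3$2, \<alpha>^2 * R$3$3]]"

text \<open>The bracket of the simple form after summation over the orbit; its single denominator
  can be cleared at once.\<close>

definition pole_form :: "complex \<Rightarrow> mat3 \<Rightarrow> complex \<Rightarrow> mat3" where
  "pole_form \<alpha> R z = mat 1 + (3 / (z^3 - \<alpha>^3)) *\<^sub>M residue_numerator \<alpha> R z"

lemma cube_eq_iff: "z ^ 3 = \<alpha> ^ 3 \<longleftrightarrow> z \<in> {\<alpha>, eps^2 * \<alpha>, eps^4 * \<alpha>}"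
proof -
  have "z ^ 3 - \<alpha> ^ 3 = (z - \<alpha>) * (z - eps^2 * \<alpha>) * (z - eps^4 * \<alpha>)"
    using eps_square by algebra
  thus ?thesis by (metis empty_iff insert_iff mult_eq_0_iff right_minus_eq)
qed

text \<open>In each entry the scalar factors 1, \<epsilon>^2, \<epsilon>^4 combine with the factors
  from the conjugation to one of the three characters: the diagonal keeps \<alpha>^2, the positions
  (1,2), (2,3), (3,1) keep z^2, the others \<alpha> z.\<close>

lemma pole_form_eq:
  assumes "z ^ 3 \<noteq> \<alpha> ^ 3"
  shows "mat 1 + (1 / (z - \<alpha>)) *\<^sub>M R
      + (eps ^ 2 / (z - eps ^ 2 * \<alpha>)) *\<^sub>M (matrix_inv Qmat ** R ** Qmat)
      + (eps ^ 4 / (z - eps ^ 4 * \<alpha>)) *\<^sub>M (Qmat ** R ** matrix_inv Qmat) = pole_form \<alpha> R z"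
proof -
  define N s0 s1 s2 where "N = 3 / (z^3 - \<alpha>^3)" and "s0 = 1 / (z - \<alpha>)"
    and "s1 = 1 / (z - eps^2 * \<alpha>)" and "s2 = 1 / (z - eps^4 * \<alpha>)"
  note pf = root_orbit_partial_fractions[OF assms]
  have "N * \<alpha>^2 = s0 + eps^2 * s1 + eps^4 * s2" "N * z^2 = s0 + s1 + s2"
    "N * (\<alpha> * z) = s0 + eps^4 * s1 + eps^2 * s2"
    using pf by (simp_all add: N_def s0_def s1_def s2_def)
  hence N: "N * (\<alpha>^2 * x) = (s0 + eps^2 * s1 + eps^4 * s2) * x" "N * (z^2 * x) = (s0 + s1 + s2) * x"
    "N * (\<alpha> * z * x) = (s0 + eps^4 * s1 + eps^2 * s2) * x" for x
    by (metis mult.assoc)+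
  have s: "eps^2 / (z - eps^2 * \<alpha>) = eps^2 * s1" "eps^4 / (z - eps^4 * \<alpha>) = eps^4 * s2"
    by (simp_all add: s1_def s2_def)
  show ?thesis
    unfolding pole_form_def residue_numerator_def s matrix_inv_Qmat N_def[symmetric] s0_def[symmetric]
    by (rule mat3_eqI; simp only: vector_add_component cscale_component mat3_of_component N
          Qmat_def diag3_mult_component)
       (simp_all add: eps_square eps_power eps_mult_left algebra_simps)
qed

lemma has_simple_form_iff:
  "has_simple_form g \<alpha> A R \<longleftrightarrow> is_diagonal A \<and> (\<forall>z. z ^ 3 \<noteq> \<alpha> ^ 3 \<longrightarrow> g z = A ** pole_form \<alpha> R z)"
  unfolding has_simple_form_def cube_eq_iff[symmetric] by (auto simp: pole_form_eq)

lemma g_elt_eq: "g_elt \<alpha> (line_of b c) z = pole_form \<alpha> ((2 * \<alpha> / 3) *\<^sub>M g_residue b c) z"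
proof -
  \<comment> \<open>With the reciprocals as atoms the claim is a ring identity, which also covers
    the points where a denominator is 0 and its reciprocal is 0 by convention.\<close>
  define w where "w = inverse (z^3 - \<alpha>^3)"
  define E where "E = inverse (2 * b * c - 1)"
  have w: "2 / (z^3 - \<alpha>^3) = 2 * w" "3 / (z^3 - \<alpha>^3) = 3 * w" and E: "x / (2 * b * c - 1) = x * E" for x
    by (simp_all add: w_def E_def divide_inverse)
  show ?thesis
    unfolding g_elt_def g_residue_def pole_form_def residue_numerator_def line_rep_line_of Let_def
      vector_3 E w
    by (rule mat3_eqI) (simp_all add: algebra_simps diff_divide_distrib power2_eq_square power3_eq_cube)
qed

lemma m_elt_eq: "m_elt \<alpha> (line_of b c) z = pole_form \<alpha> ((2 * \<alpha> / 3) *\<^sub>M m_residue b c) z"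
proof -
  define w where "w = inverse (z^3 - \<alpha>^3)"
  define E where "E = inverse (2 * b * c - 1)"
  have w: "2 / (z^3 - \<alpha>^3) = 2 * w" "3 / (z^3 - \<alpha>^3) = 3 * w" and E: "x / (2 * b * c - 1) = x * E" for x
    by (simp_all add: w_def E_def divide_inverse)
  show ?thesis
    unfolding m_elt_def m_residue_def pole_form_def residue_numerator_def line_rep_line_of Let_def
      vector_3 E w
    by (rule mat3_eqI) (simp_all add: algebra_simps diff_divide_distrib power2_eq_square power3_eq_cube)
qed

section \<open>Ranks of the residues\<close>

lemma rank_g_residue: "k \<noteq> 0 \<Longrightarrow> rank (k *\<^sub>M g_residue b c) = 1"
  by (rule rank_eq_1[where x = "c / (2 * b * c - 1)" and y = b])
     (simp_all add: vec_eq_iff forall_3 g_residue_def Let_def power2_eq_square)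

text \<open>The upper left 2 x 2 minor of \<open>m_residue b c\<close> is (2bc - 1) / D = 1. The row
  (b, c/D, 1) annihilates the matrix from the left, which gives the coefficients for its third
  row.\<close>

lemma rank_m_residue:
  assumes "k \<noteq> 0" "2 * b * c \<noteq> 1"
  shows "rank (k *\<^sub>M m_residue b c) = 2"
proof (rule rank_eq_2[where i = 1 and j = 2 and x = "- b" and y = "- c / (2 * b * c - 1)"])
  have D: "2 * b * c - 1 \<noteq> 0" using assms(2) by simp
  have "(k *\<^sub>M m_residue b c) $ 1 $ 1 * (k *\<^sub>M m_residue b c) $ 2 $ 2
     - (k *\<^sub>M m_residue b c) $ 1 $ 2 * (k *\<^sub>M m_residue b c) $ 2 $ 1 = k ^ 2"
  proof -
    define E where "E = inverse (2 * b * c - 1)"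
    have E: "x / (2 * b * c - 1) = x * E" for x by (simp add: E_def divide_inverse)
    have "E * (2 * b * c - 1) = 1" using D by (simp add: E_def)
    hence "k^2 * (E * (2 * b * c - 1)) = k^2" by simp
    thus ?thesis unfolding m_residue_def Let_def E by (simp add: algebra_simps power2_eq_square)
  qed
  thus "(k *\<^sub>M m_residue b c) $ 1 $ 1 * (k *\<^sub>M m_residue b c) $ 2 $ 2
      \<noteq> (k *\<^sub>M m_residue b c) $ 1 $ 2 * (k *\<^sub>M m_residue b c) $ 2 $ 1"
    using assms(1) by (metis power_not_zero right_minus_eq)
  show "(k *\<^sub>M m_residue b c) $ 3 = (- b) *s (k *\<^sub>M m_residue b c) $ 1
     + (- c / (2 * b * c - 1)) *s (k *\<^sub>M m_residue b c) $ 2"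
    using D by (simp add: vec_eq_iff forall_3 m_residue_def Let_def field_simps power2_eq_square)
qed

lemma rank_scalar:
  assumes "k \<noteq> 0"
  shows "rank (k *\<^sub>M (mat 1 :: mat3)) = 3"
proof -
  have "invertible (k *\<^sub>M (mat 1 :: mat3))"
    unfolding invertible_def
    by (rule exI[of _ "inverse k *\<^sub>M mat 1"])
       (use assms in \<open>simp add: vec_eq_iff forall_3 matrix_mult3 mat_component\<close>)
  from rank_eq_full[OF this] show ?thesis by simp
qed

text \<open>Every product in the expansion contains z and \<alpha> only through z^3 and \<alpha>^3,
  hence through q and p. Since q = p + 2, the sum collapses to 1 + p, which is
  \<open>ratio \<alpha> z\<close>.\<close>

lemma det_g_elt:
  assumes "z ^ 3 \<noteq> \<alpha> ^ 3" "2 * b * c \<noteq> 1"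
  shows "det (g_elt \<alpha> (line_of b c) z) = ratio \<alpha> z"
proof -
  define D where "D = 2 * b * c - 1"
  define k where "k = 2 / (z^3 - \<alpha>^3)"
  define p q where "p = k * \<alpha>^3" and "q = k * z^3"
  have "k * (z^3 - \<alpha>^3) = 2"
    using assms(1) unfolding k_def
    by (simp only: right_minus_eq times_divide_eq_left nonzero_mult_div_cancel_right
        simp_thms not_False_eq_True)
  hence "q = p + 2" by (simp add: p_def q_def algebra_simps)
  have "D \<noteq> 0" using assms(2) by (simp add: D_def)
  \<comment> \<open>With \<open>c'\<close> for c / D the determinant is a polynomial, and the
    relation between c and \<open>c'\<close> enters once, in the final cancellation.\<close>
  define c' where "c' = c / D"
  have c': "c = c' * (2 * b * c - 1)" using \<open>D \<noteq> 0\<close> by (simp add: c'_def flip: D_def)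
  have "ratio \<alpha> z = 1 + k * \<alpha>^3" using assms(1) by (simp add: ratio_def k_def field_simps)
  moreover have "det (g_elt \<alpha> (line_of b c) z) = 1 + k * \<alpha>^3"
  proof -
    have "g_elt \<alpha> (line_of b c) z = mat 1 + k *\<^sub>M mat3_of
       [[\<alpha> ^ 3 * b * c', \<alpha> * z ^ 2 * c * c', \<alpha> ^ 2 * z * c'],
        [\<alpha> ^ 2 * z * b ^ 2, \<alpha> ^ 3 * b * c, \<alpha> * z ^ 2 * b],
        [\<alpha> * z ^ 2 * b, \<alpha> ^ 2 * z * c, \<alpha> ^ 3]]"
      by (rule mat3_eqI) (simp_all add: g_elt_def Let_def vector_3 k_def D_def c'_def power2_eq_square)
    hence "det (g_elt \<alpha> (line_of b c) z) =
       (1 + k * (\<alpha> ^ 3 * b * c')) * (1 + k * (\<alpha> ^ 3 * b * c)) * (1 + k * \<alpha> ^ 3)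
       + (k * (\<alpha> * z ^ 2 * c * c')) * (k * (\<alpha> * z ^ 2 * b)) * (k * (\<alpha> * z ^ 2 * b))
       + (k * (\<alpha> ^ 2 * z * c')) * (k * (\<alpha> ^ 2 * z * b ^ 2)) * (k * (\<alpha> ^ 2 * z * c))
       - (1 + k * (\<alpha> ^ 3 * b * c')) * (k * (\<alpha> * z ^ 2 * b)) * (k * (\<alpha> ^ 2 * z * c))
       - (k * (\<alpha> * z ^ 2 * c * c')) * (k * (\<alpha> ^ 2 * z * b ^ 2)) * (1 + k * \<alpha> ^ 3)
       - (k * (\<alpha> ^ 2 * z * c')) * (1 + k * (\<alpha> ^ 3 * b * c)) * (k * (\<alpha> * z ^ 2 * b))"
      by (simp add: det_3 mat_component)
    also have "\<dots> = (1 + p * b * c') * (1 + p * b * c) * (1 + p) + p * q^2 * b^2 * c * c'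
       + p^2 * q * b^2 * c * c' - (1 + p * b * c') * p * q * b * c
       - p * q * b^2 * c * c' * (1 + p) - p * q * b * c' * (1 + p * b * c)"
      by (simp add: p_def q_def algebra_simps power2_eq_square power3_eq_cube)
    also have "\<dots> = 1 + p + p * b * (c' * (2 * b * c - 1) - c)"
      unfolding \<open>q = p + 2\<close> by (simp add: algebra_simps power2_eq_square)
    also have "\<dots> = 1 + k * \<alpha>^3"
      using c' by (simp add: p_def)
    finally show ?thesis .
  qed
  ultimately show ?thesis by simp
qed

text \<open>Away from z^3 = -\<alpha>^3 the value is ratio^3 / ratio, because m is ratio times g at
  -z and the ratio at -z is the reciprocal one. The direct expansion covers the points with z^3 =
  -\<alpha>^3 as well.\<close>

lemma det_m_elt:
  assumes "z ^ 3 \<noteq> \<alpha> ^ 3" "2 * b * c \<noteq> 1"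
  shows "det (m_elt \<alpha> (line_of b c) z) = ratio \<alpha> z ^ 2"
proof -
  define D where "D = 2 * b * c - 1"
  define k where "k = 2 / (z^3 - \<alpha>^3)"
  define p q where "p = k * \<alpha>^3" and "q = k * z^3"
  have "k * (z^3 - \<alpha>^3) = 2"
    using assms(1) unfolding k_def
    by (simp only: right_minus_eq times_divide_eq_left nonzero_mult_div_cancel_right
        simp_thms not_False_eq_True)
  hence "q = p + 2" by (simp add: p_def q_def algebra_simps)
  have "D \<noteq> 0" using assms(2) by (simp add: D_def)
  define c' where "c' = c / D"
  have c': "c = c' * (2 * b * c - 1)" using \<open>D \<noteq> 0\<close> by (simp add: c'_def flip: D_def)
  have e: "(b * c - 1) / D = 1 - b * c'"
    using \<open>D \<noteq> 0\<close> unfolding c'_def by (simp add: field_simps) (simp add: D_def)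
  have "ratio \<alpha> z = 1 + p" using assms(1) by (simp add: ratio_def p_def k_def field_simps)
  moreover have "det (m_elt \<alpha> (line_of b c) z) = (1 + p)^2"
  proof -
    have "m_elt \<alpha> (line_of b c) z = mat 1 + k *\<^sub>M mat3_of
       [[\<alpha> ^ 3 * (1 - b * c'), - (\<alpha> * z ^ 2 * c * c'), \<alpha> ^ 2 * z * c'],
        [\<alpha> ^ 2 * z * b ^ 2, \<alpha> ^ 3 * (1 - b * c), - (\<alpha> * z ^ 2 * b)],
        [- (\<alpha> * z ^ 2 * b), \<alpha> ^ 2 * z * c, 0]]"
      unfolding e[symmetric]
      by (rule mat3_eqI) (simp_all add: m_elt_def Let_def vector_3 k_def D_def c'_def power2_eq_square)
    hence "det (m_elt \<alpha> (line_of b c) z) =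
       (1 + k * (\<alpha> ^ 3 * (1 - b * c'))) * (1 + k * (\<alpha> ^ 3 * (1 - b * c)))
       - (k * (\<alpha> * z ^ 2 * c * c')) * (k * (\<alpha> * z ^ 2 * b)) * (k * (\<alpha> * z ^ 2 * b))
       + (k * (\<alpha> ^ 2 * z * c')) * (k * (\<alpha> ^ 2 * z * b ^ 2)) * (k * (\<alpha> ^ 2 * z * c))
       + (1 + k * (\<alpha> ^ 3 * (1 - b * c'))) * (k * (\<alpha> * z ^ 2 * b)) * (k * (\<alpha> ^ 2 * z * c))
       + (k * (\<alpha> * z ^ 2 * c * c')) * (k * (\<alpha> ^ 2 * z * b ^ 2))
       + (k * (\<alpha> ^ 2 * z * c')) * (1 + k * (\<alpha> ^ 3 * (1 - b * c))) * (k * (\<alpha> * z ^ 2 * b))"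
      by (simp add: det_3 mat_component)
    also have "\<dots> = (1 + p * (1 - b * c')) * (1 + p * (1 - b * c)) - p * q^2 * b^2 * c * c'
       + p^2 * q * b^2 * c * c' + (1 + p * (1 - b * c')) * p * q * b * c
       + p * q * b^2 * c * c' + p * q * b * c' * (1 + p * (1 - b * c))"
      by (simp add: p_def q_def algebra_simps power2_eq_square power3_eq_cube)
    also have "\<dots> = (1 + p)^2 - p * (1 + p)^2 * b * (c' * (2 * b * c - 1) - c)"
      unfolding \<open>q = p + 2\<close> by (simp add: algebra_simps power2_eq_square)
    also have "\<dots> = (1 + p)^2"
      using c' by simp
    finally show ?thesis .
  qed
  ultimately show ?thesis by simp
qed

text \<open>The product of \<open>ratio \<alpha> z\<close> with the prefactor of g at -z is -k.
  Entries odd in z change sign twice and entries in z^2 once, while the diagonal picks up the ratio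
  1 + k \<alpha>^3 from the identity matrix.\<close>

lemma m_elt_eq_ratio_g_elt:
  assumes "z ^ 3 \<noteq> \<alpha> ^ 3" "z ^ 3 \<noteq> - (\<alpha> ^ 3)" "2 * b * c \<noteq> 1"
  shows "m_elt \<alpha> (line_of b c) z = ratio \<alpha> z *\<^sub>M g_elt \<alpha> (line_of b c) (- z)"
proof -
  define D where "D = 2 * b * c - 1"
  define k where "k = 2 / (z^3 - \<alpha>^3)"
  have "D \<noteq> 0" using assms(3) by (simp add: D_def)
  define c' where "c' = c / D"
  have c': "x * c / D = x * c'" "c / D = c'" for x by (simp_all add: c'_def)
  have cD: "x * c^2 / D = x * c * c'" for x by (simp add: c'_def power2_eq_square)
  have e: "x * (b * c - 1) / D = x * (1 - b * c')" for x
    using \<open>D \<noteq> 0\<close> unfolding c'_def by (simp add: field_simps) (simp add: D_def algebra_simps)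
  have "z^3 + \<alpha>^3 \<noteq> 0" using assms(2) by (simp add: eq_neg_iff_add_eq_0)
  moreover have "(- z)^3 - \<alpha>^3 = - (z^3 + \<alpha>^3)" by (simp add: power3_eq_cube)
  ultimately have "2 / ((- z)^3 - \<alpha>^3) = - (2 / (z^3 + \<alpha>^3))" by (simp only: minus_divide_right)
  moreover have "(q / p) * (- (2 / q)) = - (2 / p)" if "q \<noteq> 0" for p q :: complex
    using that by simp
  ultimately have r: "ratio \<alpha> z * (2 / ((- z)^3 - \<alpha>^3)) = - k"
    using \<open>z^3 + \<alpha>^3 \<noteq> 0\<close> by (simp only: ratio_def k_def)
  have r1: "ratio \<alpha> z = 1 + k * \<alpha>^3" using assms(1) by (simp add: ratio_def k_def field_simps)
  have "ratio \<alpha> z *\<^sub>M g_elt \<alpha> (line_of b c) (- z) =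
    ratio \<alpha> z *\<^sub>M mat 1 + (ratio \<alpha> z * (2 / ((- z)^3 - \<alpha>^3))) *\<^sub>M mat3_of
       [[\<alpha> ^ 3 * b * c / D,    \<alpha> * z ^ 2 * c ^ 2 / D, - (\<alpha> ^ 2 * z * c / D)],
        [- (\<alpha> ^ 2 * z * b ^ 2),    \<alpha> ^ 3 * b * c,         \<alpha> * z ^ 2 * b],
        [\<alpha> * z ^ 2 * b,        - (\<alpha> ^ 2 * z * c),         \<alpha> ^ 3]]"
    by (rule mat3_eqI) (simp_all add: g_elt_def Let_def vector_3 D_def distrib_left mat_component)
  also have "\<dots> = m_elt \<alpha> (line_of b c) z"
    unfolding r
    unfolding r1 m_elt_def line_rep_line_of Let_def vector_3 D_def[symmetric] k_def[symmetric]
      minus_divide_left[symmetric]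
    by (rule mat3_eqI) (simp_all only: vector_add_component cscale_component mat3_of_component e c' cD,
         simp_all add: algebra_simps mat_component)
  finally show ?thesis ..
qed

lemma line_times_inv_diag3:
  assumes "d \<noteq> 0" "s = 1 \<or> s = -1"
  shows "line_times (line_of b c) (matrix_inv (diag3 d (inverse d) s)) = line_of (s * b / d) (s * c * d)"
proof -
  have s: "s \<noteq> 0" "s * s = 1" "inverse s = s" using assms(2) by auto
  have A: "matrix_inv (diag3 d (inverse d) s) = diag3 (inverse d) d s"
    using assms(1) s by (simp add: matrix_inv_diag3)
  \<comment> \<open>The image has third coordinate k s. As s is its own inverse, extracting k s
    leaves a vector with last coordinate 1.\<close>
  have *: "(k *s vector [b, c, 1]) v* diag3 (inverse d) d s = (k * s) *s vector [s * b / d, s * c * d, 1]" for k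
    using s assms(1) by (simp add: vec_eq_iff forall_3 vector_matrix_mult_def sum_3 vector_3 field_simps)
  show ?thesis
    unfolding line_times_def line_of_def vec.span_singleton A image_image *
  proof (intro equalityI subsetI)
    fix x assume "x \<in> range (\<lambda>k. k *s vector [s * b / d, s * c * d, 1])"
    then obtain k where "x = k *s vector [s * b / d, s * c * d, 1]" by blast
    hence "x = (k * s * s) *s vector [s * b / d, s * c * d, 1]" using s by (simp add: mult.assoc)
    thus "x \<in> range (\<lambda>k. (k * s) *s vector [s * b / d, s * c * d, 1])" by blast
  qed blast
qed

text \<open>Conjugation by A scales the (i, j) entry by the quotient of the i-th and j-th diagonal
  entries. The change of b and c produces the same factors and preserves bc, hence the denominator
  2bc - 1.\<close>

lemma g_elt_conjugate:
  assumes "d \<noteq> 0" "s = 1 \<or> s = -1"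
  shows "diag3 d (inverse d) s ** g_elt \<alpha> (line_of b c) z
    = g_elt \<alpha> (line_of (s * b / d) (s * c * d)) z ** diag3 d (inverse d) s"
proof -
  have s: "s * s = 1" "s * (s * x) = x" for x using assms(2) by auto
  have bc: "(s * b / d) * (s * c * d) = b * c" "2 * (s * b / d) * (s * c * d) = 2 * b * c"
    using assms s by (auto simp: field_simps)
  define w E where "w = 2 / (z^3 - \<alpha>^3)" and "E = inverse (2 * b * c - 1)"
  have E: "x / (2 * b * c - 1) = x * E" for x by (simp add: E_def divide_inverse)
  show ?thesis
    unfolding g_elt_def line_rep_line_of Let_def vector_3 bc E w_def[symmetric]
    by (rule mat3_eqI)
       (use assms s in \<open>auto simp: diag3_mult_component mat_component power2_eq_square field_simps\<close>)
qed

section \<open>From the twist to the residue equation\<close>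

lemma eventually_notin_finite:
  fixes a :: "'a::t1_space"
  assumes "finite S"
  shows "eventually (\<lambda>z. z \<notin> S) (at a)"
proof -
  have "open (- (S - {a}))" using assms by (intro open_Compl finite_imp_closed) simp
  thus ?thesis by (subst eventually_at_topological) blast
qed

lemma finite_cube_roots: "finite {z. z ^ 3 = (w :: complex) ^ 3}"
  unfolding cube_eq_iff by simp

lemma norm_eps [simp]: "cmod eps = 1"
  by (simp add: eps_def norm_exp)

lemma eps_mult_I_dom: "z \<in> I_dom r \<Longrightarrow> eps * z \<in> I_dom r"
  by (simp add: I_dom_def norm_mult)

lemma open_I_dom: "open (I_dom r)"
  unfolding I_dom_def by (intro open_Un open_Collect_less continuous_intros)

lemma ball_subset_I_dom: "ball 0 r \<subseteq> I_dom r"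
  by (auto simp: I_dom_def)

lemma diagonal_fixed_by_sigma:
  assumes "is_diagonal A" "A ** Pmat ** transpose A = Pmat"
  obtains d s where "d \<noteq> 0" "s = 1 \<or> s = -1" "A = diag3 d (inverse d) s"
proof -
  have A: "A$1$2 = 0" "A$1$3 = 0" "A$2$1 = 0" "A$2$3 = 0" "A$3$1 = 0" "A$3$2 = 0"
    using assms(1) by (simp_all add: is_diagonal_def)
  \<comment> \<open>\<open>Pmat\<close> pairs the first two coordinates and fixes the third, so the
    first two diagonal entries are inverse to each other and the third squares to 1.\<close>
  have "A$1$1 * eps^4 * A$2$2 = eps^4" "A$3$3 * A$3$3 = 1"
    using arg_cong[OF assms(2), of "\<lambda>X. X$1$2"] arg_cong[OF assms(2), of "\<lambda>X. X$3$3"]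
    by (simp_all add: matrix_mult3 A Pmat_def)
  hence 1: "A$1$1 * A$2$2 = 1" and 3: "A$3$3 = 1 \<or> A$3$3 = -1"
    by (simp_all add: square_eq_1_iff)
  have "A = diag3 (A$1$1) (inverse (A$1$1)) (A$3$3)"
    using inverse_unique[OF 1] by (intro mat3_eqI) (simp_all add: A)
  moreover have "A$1$1 \<noteq> 0" using 1 by auto
  ultimately show thesis using that 3 by blast
qed

text \<open>The factor 2\<alpha>/3 is chosen so that both matrices become 2\<alpha>^3 times a matrix
  free of \<alpha>: the cleared denominator contributes -2\<alpha>^3 at \<alpha>, and 3 \<alpha>^2
  (2\<alpha>/3) is 2\<alpha>^3.\<close>

lemma residue_condition:
  assumes "\<alpha> \<noteq> 0"
    and "((- 2 * \<alpha>^3) *\<^sub>M mat 1 + 3 *\<^sub>M residue_numerator \<alpha> ((2 * \<alpha> / 3) *\<^sub>M M) (eps * \<alpha>)) ** Pmat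
      ** transpose (3 *\<^sub>M residue_numerator \<alpha> ((2 * \<alpha> / 3) *\<^sub>M M) \<alpha>) = 0"
  shows "M ** transpose (residue_defect M) = 0"
proof -
  define X where "X = mat3_of
     [[M$1$1 - 1, eps^2 * M$1$2, eps * M$1$3],
      [eps * M$2$1, M$2$2 - 1, eps^2 * M$2$3],
      [eps^2 * M$3$1, eps * M$3$2, M$3$3 - 1]]"
  have "(- 2 * \<alpha>^3) *\<^sub>M mat 1 + 3 *\<^sub>M residue_numerator \<alpha> ((2 * \<alpha> / 3) *\<^sub>M M) (eps * \<alpha>) = (2 * \<alpha>^3) *\<^sub>M X"
    by (rule mat3_eqI)
       (simp_all add: X_def residue_numerator_def mat_component power2_eq_square power3_eq_cube algebra_simps)
  moreover have "3 *\<^sub>M residue_numerator \<alpha> ((2 * \<alpha> / 3) *\<^sub>M M) \<alpha> = (2 * \<alpha>^3) *\<^sub>M M"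
    by (rule mat3_eqI)
       (simp_all add: residue_numerator_def power2_eq_square power3_eq_cube)
  ultimately have "(((2 * \<alpha>^3) *\<^sub>M X) ** Pmat ** transpose ((2 * \<alpha>^3) *\<^sub>M M)) $ i $ j = 0" for i j
    using assms(2) by simp
  hence "(2 * \<alpha>^3)^2 * (X ** Pmat ** transpose M) $ i $ j = 0" for i j
    by (simp add: matrix_mult3 algebra_simps power2_eq_square)
  hence XPM: "(X ** Pmat ** transpose M) $ i $ j = 0" for i j
    using assms(1) by simp
  \<comment> \<open>The rows of \<open>X ** Pmat\<close> are those of
    \<open>residue_defect M\<close> multiplied by -\<epsilon>^4, -\<epsilon>^2 and -1, so the
    product is the transpose of the wanted one up to nonzero row factors.\<close>
  have "- (eps ^ 4) * (M ** transpose (residue_defect M)) $ i $ 1 = (X ** Pmat ** transpose M) $ 1 $ i" for i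
    by (simp add: matrix_mult3 X_def residue_defect_def Pmat_def eps_power eps_square eps_mult_left algebra_simps)
  hence 1: "(M ** transpose (residue_defect M)) $ i $ 1 = 0" for i by (simp add: XPM)
  have "- (eps ^ 2) * (M ** transpose (residue_defect M)) $ i $ 2 = (X ** Pmat ** transpose M) $ 2 $ i" for i
    by (simp add: matrix_mult3 X_def residue_defect_def Pmat_def eps_power eps_square eps_mult_left algebra_simps)
  hence 2: "(M ** transpose (residue_defect M)) $ i $ 2 = 0" for i by (simp add: XPM)
  have "- ((M ** transpose (residue_defect M)) $ i $ 3) = (X ** Pmat ** transpose M) $ 3 $ i" for i
    by (simp add: matrix_mult3 X_def residue_defect_def Pmat_def eps_power eps_square eps_mult_left algebra_simps)
  hence 3: "(M ** transpose (residue_defect M)) $ i $ 3 = 0" for i by (simp add: XPM)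
  show ?thesis by (rule mat3_eqI) (simp_all add: 1 2 3)
qed

text \<open>With denominators cleared, both sides are entire and agree on a disc below the poles,
  hence everywhere. At \<alpha> the right side vanishes because of the factor z^3 -
  \<alpha>^3.\<close>

lemma twist_identity_residue:
  assumes "\<alpha> \<noteq> 0" "0 < \<rho>" "\<rho> \<le> cmod \<alpha>"
    and tw: "\<And>z. cmod z < \<rho> \<Longrightarrow> pole_form \<alpha> R (eps * z) ** Pmat ** transpose (pole_form \<alpha> R z) = Pmat"
  shows "((- 2 * \<alpha>^3) *\<^sub>M mat 1 + 3 *\<^sub>M residue_numerator \<alpha> R (eps * \<alpha>)) ** Pmat
      ** transpose (3 *\<^sub>M residue_numerator \<alpha> R \<alpha>) = 0"
proof -
  define X where "X = (\<lambda>z. (- (z^3) - \<alpha>^3) *\<^sub>M mat 1 + 3 *\<^sub>M residue_numerator \<alpha> R (eps * z))"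
  define Y where "Y = (\<lambda>z. (z^3 - \<alpha>^3) *\<^sub>M mat 1 + 3 *\<^sub>M residue_numerator \<alpha> R z)"
  define F where "F = (\<lambda>i j z. (X z ** Pmat ** transpose (Y z)) $ i $ j
     - (- (z^3) - \<alpha>^3) * (z^3 - \<alpha>^3) * Pmat $ i $ j)"
  have num: "(\<lambda>z. residue_numerator \<alpha> R (c * z) $ i $ j) holomorphic_on UNIV" for c i j
    using exhaust_3[of i] exhaust_3[of j]
    by (elim disjE; simp add: residue_numerator_def; intro holomorphic_intros)
  have XY: "(\<lambda>z. X z $ i $ j) holomorphic_on UNIV" "(\<lambda>z. Y z $ i $ j) holomorphic_on UNIV" for i j
    using num[of eps i j] num[of 1 i j] unfolding X_def Y_def vector_add_component cscale_component
    by (auto intro!: holomorphic_intros)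
  have hol: "F i j holomorphic_on UNIV" for i j
    unfolding F_def matrix_mult3 transpose_component
    by (intro holomorphic_intros XY)
  have zero: "F i j z = 0" if "z \<in> ball 0 \<rho>" for i j z
  proof -
    have nz: "cmod z < cmod \<alpha>" using that assms(3) by simp
    hence "cmod z ^ 3 < cmod \<alpha> ^ 3" by (intro power_strict_mono) auto
    hence less: "cmod (z^3) < cmod (\<alpha>^3)" by (simp add: norm_power)
    hence n1: "z^3 - \<alpha>^3 \<noteq> 0" by auto
    have "- (z^3) \<noteq> \<alpha>^3"
    proof
      assume "- (z^3) = \<alpha>^3"
      hence "cmod (z^3) = cmod (\<alpha>^3)" by (metis norm_minus_cancel)
      with less show False by simp
    qed
    hence n2: "- (z^3) - \<alpha>^3 \<noteq> 0" by simp
    note n = n1 n2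
    have e: "(eps * z)^3 = - (z^3)" by (simp add: power_mult_distrib eps_power)
    have "X z = (- (z^3) - \<alpha>^3) *\<^sub>M pole_form \<alpha> R (eps * z)" "Y z = (z^3 - \<alpha>^3) *\<^sub>M pole_form \<alpha> R z"
      using n by (auto simp: X_def Y_def pole_form_def e vec_eq_iff distrib_left)
    hence "X z ** Pmat ** transpose (Y z)
      = ((- (z^3) - \<alpha>^3) * (z^3 - \<alpha>^3)) *\<^sub>M (pole_form \<alpha> R (eps * z) ** Pmat ** transpose (pole_form \<alpha> R z))"
      by (simp add: vec_eq_iff matrix_mult3 distrib_left mult_ac)
    with tw[of z] that show ?thesis by (simp add: F_def)
  qed
  have F0: "F i j \<alpha> = 0" for i j
    by (rule analytic_continuation_open[of "ball 0 \<rho>" UNIV "F i j" "\<lambda>_. 0"])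
       (use assms(2) zero hol in auto)
  have "X \<alpha> ** Pmat ** transpose (Y \<alpha>) = 0"
    using F0 by (simp add: F_def vec_eq_iff)
  moreover have "X \<alpha> = (- 2 * \<alpha>^3) *\<^sub>M mat 1 + 3 *\<^sub>M residue_numerator \<alpha> R (eps * \<alpha>)"
    "Y \<alpha> = 3 *\<^sub>M residue_numerator \<alpha> R \<alpha>"
    by (simp_all add: X_def Y_def vec_eq_iff)
  ultimately show ?thesis by simp
qed

text \<open>Recovers the value at a point that the formula for f leaves out; the simple form
  prescribes nothing where z^3 = \<alpha>^3.\<close>

lemma holomorphic_eq_at:
  assumes "f holomorphic_on S" "open S" "a \<in> S" "eventually (\<lambda>z. f z = c) (at a)"
  shows "f a = c"
proof -
  have "f \<midarrow>a\<rightarrow> f a"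
    using assms(1-3) holomorphic_on_imp_continuous_on[OF assms(1)]
    by (simp add: continuous_on_eq_continuous_at isCont_def)
  moreover have "f \<midarrow>a\<rightarrow> c" using assms(4) by (rule tendsto_eventually)
  ultimately show ?thesis by (rule tendsto_unique[OF trivial_limit_at])
qed

section \<open>The value at infinity and degenerate data\<close>

lemma tendsto_simple_fraction_at_infinity: "((\<lambda>z. c / (z - a)) \<longlongrightarrow> (0::complex)) at_infinity"
proof -
  have "filterlim (\<lambda>z. z + (- a)) at_infinity at_infinity"
    by (rule tendsto_add_filterlim_at_infinity') (auto intro: filterlim_ident)
  thus ?thesis by (intro tendsto_divide_0[OF tendsto_const]) simp
qed

lemma loop_group_limit_at_infinity:
  assumes "g \<in> loop_group r" "0 < r"
  obtains L where "invertible L" "sigma L = L" "\<And>i j. ((\<lambda>z. g z $ i $ j) \<longlongrightarrow> L $ i $ j) at_infinity"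
proof -
  from assms(1) obtain L where hol: "matrix_holomorphic_on (\<lambda>w. if w = 0 then L else g (1 / w)) (ball 0 r)"
    and L: "invertible L" "sigma L = L"
    unfolding loop_group_def by blast
  have "((\<lambda>z. g z $ i $ j) \<longlongrightarrow> L $ i $ j) at_infinity" for i j
  proof (rule lim_zero_infinity)
    let ?h = "\<lambda>w. (if w = 0 then L else g (1 / w)) $ i $ j"
    have "?h holomorphic_on ball 0 r" using hol by (simp add: matrix_holomorphic_on_def)
    hence "continuous_on (ball 0 r) ?h" by (rule holomorphic_on_imp_continuous_on)
    hence "isCont ?h 0" using assms(2) by (simp add: continuous_on_eq_continuous_at)
    hence "?h \<midarrow>0\<rightarrow> L $ i $ j" by (simp add: isCont_def)
    moreover have "eventually (\<lambda>w. ?h w = g (1 / w) $ i $ j) (at 0)"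
      by (auto simp: eventually_at_filter)
    ultimately show "(\<lambda>w. g (1 / w) $ i $ j) \<midarrow>0\<rightarrow> L $ i $ j"
      by (rule Lim_transform_eventually)
  qed
  with L that show thesis by blast
qed

lemma loop_group_twist:
  assumes "g \<in> loop_group r" "z \<in> I_dom r"
  shows "g (eps * z) ** Pmat ** transpose (g z) = Pmat"
  using assms by (intro sigma_eq_imp) (auto simp: loop_group_def)

lemma matrix_cancel_conjugation:
  fixes A X Y :: mat3
  assumes "invertible A" "A ** X ** transpose A = A ** Y ** transpose A"
  shows "X = Y"
proof -
  let ?B = "matrix_inv A"
  have B: "?B ** A = mat 1" "transpose A ** transpose ?B = mat 1"
    using matrix_inv_works[OF assms(1)] by (simp_all flip: matrix_transpose_mul)
  have "Z = ?B ** (A ** Z ** transpose A) ** transpose ?B" for Z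
    using B by (metis matrix_mul_assoc matrix_mul_lid matrix_mul_rid)
  thus ?thesis using assms(2) by metis
qed

text \<open>The bracket of the simple form tends to the identity, so A is the value of g at
  infinity, which the rotation by \<epsilon> fixes.\<close>

lemma simple_form_value_at_infinity:
  assumes g: "g \<in> loop_group r" and "0 < r" and form: "has_simple_form g \<alpha> A R"
  shows "invertible A" "sigma A = A"
proof -
  obtain L where L: "invertible L" "sigma L = L" and lim: "((\<lambda>z. g z $ i $ j) \<longlongrightarrow> L $ i $ j) at_infinity" for i j
    using loop_group_limit_at_infinity[OF g \<open>0 < r\<close>] by blast
  let ?R1 = "matrix_inv Qmat ** R ** Qmat" and ?R2 = "Qmat ** R ** matrix_inv Qmat"
  define E where "E = (\<lambda>z. mat 1 + (1 / (z - \<alpha>)) *\<^sub>M R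
          + (eps ^ 2 / (z - eps ^ 2 * \<alpha>)) *\<^sub>M ?R1 + (eps ^ 4 / (z - eps ^ 4 * \<alpha>)) *\<^sub>M ?R2)"
  have E: "((\<lambda>z. E z $ k $ j) \<longlongrightarrow> mat 1 $ k $ j) at_infinity" for k j
  proof -
    have "((\<lambda>z. E z $ k $ j) \<longlongrightarrow> mat 1 $ k $ j + 0 * R $ k $ j + 0 * ?R1 $ k $ j + 0 * ?R2 $ k $ j) at_infinity"
      unfolding E_def vector_add_component cscale_component
      by (intro tendsto_intros tendsto_simple_fraction_at_infinity)
    thus ?thesis by simp
  qed
  have "((\<lambda>z. (A ** E z) $ i $ j) \<longlongrightarrow> (A ** mat 1) $ i $ j) at_infinity" for i j
    unfolding matrix_mult3 by (intro tendsto_intros E)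
  moreover have "eventually (\<lambda>z. (A ** E z) $ i $ j = g z $ i $ j) at_infinity" for i j
  proof -
    have "eventually (\<lambda>z. z \<notin> {\<alpha>, eps ^ 2 * \<alpha>, eps ^ 4 * \<alpha>}) at_infinity"
    proof -
      have "eventually (\<lambda>z. cmod z > cmod \<alpha>) at_infinity"
        by (rule eventually_at_infinityI[of "cmod \<alpha> + 1"]) simp
      thus ?thesis by eventually_elim (auto simp: norm_mult norm_power)
    qed
    thus ?thesis
      by eventually_elim (use form in \<open>simp add: has_simple_form_def E_def\<close>)
  qed
  ultimately have "((\<lambda>z. g z $ i $ j) \<longlongrightarrow> (A ** mat 1) $ i $ j) at_infinity" for i j
    by (rule Lim_transform_eventually)
  hence "((\<lambda>z. g z $ i $ j) \<longlongrightarrow> A $ i $ j) at_infinity" for i j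
    by (simp only: matrix_mul_rid)
  hence "A $ i $ j = L $ i $ j" for i j
    by (rule tendsto_unique[OF trivial_limit_at_infinity _ lim])
  hence "A = L" by (simp add: vec_eq_iff)
  with L show "invertible A" "sigma A = A" by simp_all
qed

lemma simple_form_nonzero:
  assumes g: "g \<in> loop_group r" and "0 < r" and form: "has_simple_form g \<alpha> A R"
    and nonconst: "\<not> (\<exists>C. \<forall>z \<in> I_dom r. g z = C)"
  shows "\<alpha> \<noteq> 0" "R \<noteq> 0"
proof -
  have hol: "(\<lambda>z. g z $ i $ j) holomorphic_on I_dom r" for i j
    using g by (simp add: loop_group_def matrix_holomorphic_on_def)
  have const: False if "\<And>z. z ^ 3 \<noteq> \<alpha> ^ 3 \<Longrightarrow> g z = A"
  proof -
    have "g z $ i $ j = A $ i $ j" if "z \<in> I_dom r" for z i j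
    proof (rule holomorphic_eq_at[OF hol open_I_dom that])
      show "eventually (\<lambda>z. g z $ i $ j = A $ i $ j) (at z)"
        using eventually_notin_finite[OF finite_cube_roots, of \<alpha>]
        by eventually_elim (use \<open>\<And>z. z ^ 3 \<noteq> \<alpha> ^ 3 \<Longrightarrow> g z = A\<close> in auto)
    qed
    hence "\<forall>z \<in> I_dom r. g z = A" by (auto simp: vec_eq_iff)
    with nonconst show False by blast
  qed
  have g_eq: "g z = A ** pole_form \<alpha> R z" if "z ^ 3 \<noteq> \<alpha> ^ 3" for z
    using form that by (simp add: has_simple_form_iff)
  show "R \<noteq> 0"
  proof
    assume "R = 0"
    hence "pole_form \<alpha> R z = mat 1" for z
      by (intro mat3_eqI) (simp_all add: pole_form_def residue_numerator_def mat_component)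
    with const g_eq show False by simp
  qed
  show "\<alpha> \<noteq> 0"
  proof
    assume \<alpha>: "\<alpha> = 0"
    \<comment> \<open>For \<alpha> = 0 only the entries with z^2 survive in the numerator, and z^2 /
      z^3 leaves a possible pole at 0.\<close>
    define S where "S = mat3_of [[0, R$1$2, 0], [0, 0, R$2$3], [R$3$1, 0, 0]]"
    have "pole_form \<alpha> R z = mat 1 + (3 / z) *\<^sub>M S" if "z \<noteq> 0" for z
      using that by (intro mat3_eqI)
        (simp_all add: \<alpha> pole_form_def residue_numerator_def mat_component S_def power2_eq_square power3_eq_cube)
    hence geq: "g z = A + (3 / z) *\<^sub>M (A ** S)" if "z \<noteq> 0" for z
      using g_eq[of z] that by (simp add: \<alpha> vec_eq_iff matrix_mult3 mat_component forall_3 algebra_simps)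
    have "(A ** S) $ i $ j = 0" for i j
    proof -
      \<comment> \<open>This function is 0 at 0 and equals a constant elsewhere. It is holomorphic
        near 0, a point of I, so the constant is 0.\<close>
      let ?f = "\<lambda>z. z * (g z $ i $ j - A $ i $ j)"
      have "?f 0 = 3 * (A ** S) $ i $ j"
      proof (rule holomorphic_eq_at[of ?f "I_dom r" 0])
        show "?f holomorphic_on I_dom r" by (intro holomorphic_intros hol)
        show "0 \<in> I_dom r" using \<open>0 < r\<close> by (simp add: I_dom_def)
        show "eventually (\<lambda>z. ?f z = 3 * (A ** S) $ i $ j) (at 0)"
          by (auto simp: eventually_at_filter geq)
      qed (rule open_I_dom)
      thus ?thesis by simp
    qed
    hence "A ** S = 0" by (simp add: vec_eq_iff)
    hence "g z = A" if "z ^ 3 \<noteq> \<alpha> ^ 3" for z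
      using geq[of z] that by (simp add: \<alpha> vec_eq_iff)
    with const show False by blast
  qed
qed

text \<open>A is fixed by the twist, so it can be cancelled and the twist passes to
  \<open>pole_form\<close>. The residue equation then leaves three shapes, of which the identity
  matrix makes g a scalar function times A.\<close>

lemma simple_form_structure:
  assumes g: "g \<in> loop_group r" and r: "0 < r" and form: "has_simple_form g \<alpha> A R"
    and nonconst: "\<not> (\<exists>C. \<forall>z \<in> I_dom r. g z = C)"
  shows "(\<exists>d s. d \<noteq> 0 \<and> (s = 1 \<or> s = -1) \<and> A = diag3 d (inverse d) s) \<and>
           ((rank R = 1 \<and> (\<exists>l. admissible_line l \<and>
                (\<forall>z. z ^ 3 \<noteq> \<alpha> ^ 3 \<longrightarrow> g z = A ** g_elt \<alpha> l z))) \<or>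
            (rank R = 2 \<and> (\<exists>l. admissible_line l \<and>
                (\<forall>z. z ^ 3 \<noteq> \<alpha> ^ 3 \<longrightarrow> g z = A ** m_elt \<alpha> l z))) \<or>
            (rank R = 3 \<and>
                (\<forall>z. z ^ 3 \<noteq> \<alpha> ^ 3 \<longrightarrow> g z = ratio \<alpha> z *\<^sub>M A)))"
    (is "?A \<and> ?B")
proof
  note A = simple_form_value_at_infinity[OF g r form]
  have AP: "A ** Pmat ** transpose A = Pmat" using A by (rule sigma_eq_imp)
  have "is_diagonal A" using form by (simp add: has_simple_form_iff)
  thus ?A using AP by (metis diagonal_fixed_by_sigma)
  have \<alpha>: "\<alpha> \<noteq> 0" and "R \<noteq> 0"
    using simple_form_nonzero[OF g r form nonconst] by auto
  have g_eq: "g z = A ** pole_form \<alpha> R z" if "z ^ 3 \<noteq> \<alpha> ^ 3" for z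
    using form that by (simp add: has_simple_form_iff)
  define M where "M = (3 / (2 * \<alpha>)) *\<^sub>M R"
  have R: "R = (2 * \<alpha> / 3) *\<^sub>M M" using \<alpha> by (simp add: M_def vec_eq_iff)
  have "M ** transpose (residue_defect M) = 0"
  proof (rule residue_condition[OF \<alpha>], fold R, rule twist_identity_residue[OF \<alpha>])
    \<comment> \<open>On this disc z lies in I, and neither z nor \<epsilon> z has cube
      \<alpha>^3.\<close>
    show "0 < min r (cmod \<alpha>)" "min r (cmod \<alpha>) \<le> cmod \<alpha>" using r \<alpha> by auto
    fix z assume z: "cmod z < min r (cmod \<alpha>)"
    hence "cmod z ^ 3 < cmod \<alpha> ^ 3" by (intro power_strict_mono) auto
    hence n: "cmod (z ^ 3) \<noteq> cmod (\<alpha> ^ 3)" "cmod ((eps * z) ^ 3) \<noteq> cmod (\<alpha> ^ 3)"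
      by (simp_all add: norm_power norm_mult)
    hence n': "z ^ 3 \<noteq> \<alpha> ^ 3" "(eps * z) ^ 3 \<noteq> \<alpha> ^ 3" by metis+
    have "z \<in> I_dom r" using z by (simp add: I_dom_def)
    note tw = loop_group_twist[OF g this, unfolded g_eq[OF n'(1)] g_eq[OF n'(2)]]
    show "pole_form \<alpha> R (eps * z) ** Pmat ** transpose (pole_form \<alpha> R z) = Pmat"
      by (rule matrix_cancel_conjugation[OF A(1)])
         (use tw in \<open>simp add: AP matrix_transpose_mul matrix_mul_assoc\<close>)
  qed
  moreover have "M \<noteq> 0"
  proof
    assume "M = 0"
    hence "R = 0" by (simp add: R vec_eq_iff)
    with \<open>R \<noteq> 0\<close> show False ..
  qed
  ultimately consider "M = mat 1" | b c where "2 * b * c \<noteq> 1" "M = g_residue b c"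
    | b c where "2 * b * c \<noteq> 1" "M = m_residue b c"
    using residue_classification by blast
  thus ?B
  proof cases
    case 1
    have "rank R = 3" unfolding R 1 using \<alpha> by (intro rank_scalar) simp
    moreover have "g z = ratio \<alpha> z *\<^sub>M A" if z: "z ^ 3 \<noteq> \<alpha> ^ 3" for z
    proof -
      have "ratio \<alpha> z = 1 + (3 / (z^3 - \<alpha>^3)) * (2 * \<alpha>^3 / 3)"
        using z by (simp add: ratio_def field_simps)
      hence "pole_form \<alpha> R z = ratio \<alpha> z *\<^sub>M mat 1"
        unfolding R 1 by (intro mat3_eqI)
          (simp_all add: pole_form_def residue_numerator_def mat_component power2_eq_square power3_eq_cube)
      thus ?thesis using g_eq[OF z] by (simp add: vec_eq_iff forall_3 matrix_mult3 mat_component)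
    qed
    ultimately show ?thesis by blast
  next
    case (2 b c)
    have "rank R = 1" unfolding R 2 using \<alpha> by (intro rank_g_residue) simp
    moreover have "admissible_line (line_of b c)" using 2 by (auto simp: admissible_line_def)
    moreover have "g z = A ** g_elt \<alpha> (line_of b c) z" if z: "z ^ 3 \<noteq> \<alpha> ^ 3" for z
      using g_eq[OF z] R 2 by (simp add: g_elt_eq)
    ultimately show ?thesis by blast
  next
    case (3 b c)
    have "rank R = 2" unfolding R 3 using \<alpha> 3 by (intro rank_m_residue) simp_all
    moreover have "admissible_line (line_of b c)" using 3 by (auto simp: admissible_line_def)
    moreover have "g z = A ** m_elt \<alpha> (line_of b c) z" if z: "z ^ 3 \<noteq> \<alpha> ^ 3" for z
      using g_eq[OF z] R 3 by (simp add: m_elt_eq)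
    ultimately show ?thesis by blast
  qed
qed

section \<open>Rational functions with simple poles\<close>

lemma open_poly_nonzero: "q \<noteq> 0 \<Longrightarrow> open {z :: complex. poly q z \<noteq> 0}"
  using finite_imp_closed[OF poly_roots_finite[of q]] by (simp add: open_closed Compl_eq)

lemma rational_holomorphic:
  fixes p q :: "complex poly"
  assumes "\<forall>z. poly q z \<noteq> 0 \<longrightarrow> f z = poly p z / poly q z"
  shows "f holomorphic_on {z. poly q z \<noteq> 0}"
proof -
  have "(\<lambda>z. poly p z / poly q z) holomorphic_on {z. poly q z \<noteq> 0}"
    by (intro holomorphic_intros) auto
  thus ?thesis by (rule holomorphic_transform) (use assms in auto)
qed

text \<open>In lowest terms a zero of q is not cancelled by p, so the poles of an entry are exactly
  the roots of a nonzero polynomial; in particular they are finite in number.\<close>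

lemma rational_pole_iff:
  fixes p q :: "complex poly"
  assumes "q \<noteq> 0" "coprime p q" and f: "\<forall>z. poly q z \<noteq> 0 \<longrightarrow> f z = poly p z / poly q z"
  shows "is_pole f a \<longleftrightarrow> poly q a = 0"
proof
  assume "is_pole f a"
  thus "poly q a = 0"
    using not_is_pole_holomorphic[OF open_poly_nonzero[OF assms(1)] _ rational_holomorphic[OF f]] by auto
next
  assume q: "poly q a = 0"
  hence p: "poly p a \<noteq> 0" using coprime_poly_0[OF assms(2)] by blast
  have ev: "eventually (\<lambda>z. poly q z \<noteq> 0) (at a)"
    using eventually_notin_finite[OF poly_roots_finite[OF assms(1)]] by simp
  have "poly q \<midarrow>a\<rightarrow> poly q a" using isCont_def poly_isCont by blast
  hence "filterlim (poly q) (at 0) (at a)" using q ev by (simp add: filterlim_at)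
  hence "is_pole (\<lambda>z. poly p z / poly q z) a"
    using p by (intro is_pole_divide) auto
  thus "is_pole f a"
    by (rule is_pole_transform) (use ev f in \<open>auto elim!: eventually_mono\<close>)
qed

text \<open>Write f = h / (z - a) with h holomorphic and take c = h(a); the remainder is the
  difference quotient of h, whose limit is the derivative.\<close>

lemma simple_pole_principal_part:
  assumes "open S" "a \<in> S" "f holomorphic_on S - {a}" "is_pole f a" "zorder f a = -1"
  obtains c l where "((\<lambda>z. f z - c / (z - a)) \<longlongrightarrow> l) (at a)"
proof -
  define h where "h = zor_poly f a"
  obtain \<rho> where \<rho>: "\<rho> > 0" "h holomorphic_on cball a \<rho>"
    and f: "\<And>w. w \<in> cball a \<rho> - {a} \<Longrightarrow> f w = h w / (w - a)"
    using zorder_exist_pole[OF assms(3,1,2,4)] unfolding h_def assms(5) by auto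
  have "(h has_field_derivative deriv h a) (at a)"
    by (rule holomorphic_derivI[of h "ball a \<rho>"]) (use \<rho> in \<open>auto elim: holomorphic_on_subset\<close>)
  hence "((\<lambda>z. (h z - h a) / (z - a)) \<longlongrightarrow> deriv h a) (at a)"
    by (simp add: has_field_derivative_iff)
  moreover have "eventually (\<lambda>z. (h z - h a) / (z - a) = f z - h a / (z - a)) (at a)"
    using eventually_at_in_open[OF open_ball, of a a \<rho>] \<rho>(1)
    by (auto elim!: eventually_mono simp: f diff_divide_distrib)
  ultimately have "((\<lambda>z. f z - h a / (z - a)) \<longlongrightarrow> deriv h a) (at a)"
    by (rule Lim_transform_eventually)
  thus thesis by (rule that)
qed

text \<open>Subtracting all principal parts leaves removable singularities and the limit L at
  infinity. A coefficient \<open>c a\<close> may be 0, so one set K can serve all nine entries of a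
  matrix.\<close>

lemma partial_fractions:
  fixes f :: "complex \<Rightarrow> complex"
  assumes K: "finite K" and hol: "f holomorphic_on - K"
    and pp: "\<And>a. a \<in> K \<Longrightarrow> \<exists>l. ((\<lambda>z. f z - c a / (z - a)) \<longlongrightarrow> l) (at a)"
    and inf: "(f \<longlongrightarrow> L) at_infinity" and "z \<notin> K"
  shows "f z = L + (\<Sum>a\<in>K. c a / (z - a))"
proof -
  define F0 where "F0 = (\<lambda>z. f z - (\<Sum>a\<in>K. c a / (z - a)))"
  have "\<exists>l. (F0 \<longlongrightarrow> l) (at a)" if a: "a \<in> K" for a
  proof -
    obtain l where l: "((\<lambda>z. f z - c a / (z - a)) \<longlongrightarrow> l) (at a)" using pp[OF a] by blast
    have "((\<lambda>z. (f z - c a / (z - a)) - (\<Sum>b\<in>K - {a}. c b / (z - b))) \<longlongrightarrow>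
        l - (\<Sum>b\<in>K - {a}. c b / (a - b))) (at a)"
      by (intro tendsto_intros l) auto
    moreover have "F0 = (\<lambda>z. (f z - c a / (z - a)) - (\<Sum>b\<in>K - {a}. c b / (z - b)))"
      using K a by (simp add: F0_def sum.remove fun_eq_iff)
    ultimately show ?thesis by auto
  qed
  then obtain l where l: "\<And>a. a \<in> K \<Longrightarrow> (F0 \<longlongrightarrow> l a) (at a)" by metis
  define F where "F = (\<lambda>z. if z \<in> K then l z else F0 z)"
  have F_eq: "eventually (\<lambda>z. F0 z = F z) (at a)" for a
    using eventually_notin_finite[OF K] by eventually_elim (simp add: F_def)
  have "F holomorphic_on UNIV"
  proof (rule no_isolated_singularity'[OF _ _ open_UNIV K])
    show "(F \<longlongrightarrow> F a) (at a within UNIV)" if "a \<in> K" for a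
      using Lim_transform_eventually[OF l[OF that] F_eq] that by (simp add: F_def)
    have "F0 holomorphic_on - K"
      unfolding F0_def by (intro holomorphic_intros hol) auto
    thus "F holomorphic_on UNIV - K"
      by (rule holomorphic_transform[OF holomorphic_on_subset]) (auto simp: F_def)
  qed
  moreover have "(F \<longlongrightarrow> L) at_infinity"
  proof -
    have "(F0 \<longlongrightarrow> L - (\<Sum>a\<in>K. 0)) at_infinity"
      unfolding F0_def by (intro tendsto_intros inf tendsto_simple_fraction_at_infinity)
    hence "(F0 \<longlongrightarrow> L) at_infinity" by simp
    moreover have "eventually (\<lambda>z. F0 z = F z) at_infinity"
    proof -
      obtain B where "\<forall>a\<in>K. norm a \<le> B" using finite_imp_bounded[OF K] by (auto simp: bounded_iff)
      thus ?thesis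
        by (intro eventually_at_infinityI[of "B + 1"]) (force simp: F_def)
    qed
    ultimately show ?thesis by (rule Lim_transform_eventually)
  qed
  ultimately have "F z = L" by (rule Liouville_weak)
  thus ?thesis using \<open>z \<notin> K\<close> by (simp add: F_def F0_def algebra_simps)
qed

section \<open>Poles and residues under a rotation of the variable\<close>

lemma tendsto_mult_principal_part:
  assumes "((\<lambda>z. f z - c / (z - a)) \<longlongrightarrow> l) (at (a :: complex))"
  shows "((\<lambda>z. (z - a) * f z) \<longlongrightarrow> c) (at a)"
proof -
  have "((\<lambda>z. (z - a) * (f z - c / (z - a)) + c) \<longlongrightarrow> (a - a) * l + c) (at a)"
    by (intro tendsto_intros assms)
  hence "((\<lambda>z. (z - a) * (f z - c / (z - a)) + c) \<longlongrightarrow> c) (at a)" by simp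
  moreover have "eventually (\<lambda>z. (z - a) * (f z - c / (z - a)) + c = (z - a) * f z) (at a)"
    by (auto simp: eventually_at_filter right_diff_distrib)
  ultimately show ?thesis by (rule Lim_transform_eventually)
qed

lemma filterlim_mult_at:
  fixes w a :: complex
  assumes "w \<noteq> 0"
  shows "filterlim (\<lambda>z. w * z) (at (w * a)) (at a)"
  using assms by (auto simp: filterlim_at eventually_at_filter intro!: tendsto_intros)

lemma equivariant_pole:
  fixes f :: "complex \<Rightarrow> complex"
  assumes "\<mu> \<noteq> 0" "w \<noteq> 0" "eventually (\<lambda>z. f (w * z) = \<mu> * f z) (at a)" "is_pole f a"
  shows "is_pole f (w * a)"
proof -
  have "is_pole (\<lambda>z. \<mu> * f z) a" using assms(1,4) by simp
  hence "is_pole (\<lambda>z. f (w * z)) a"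
    by (rule is_pole_transform) (use assms(3) in \<open>auto elim: eventually_mono\<close>)
  hence "filterlim (\<lambda>z. f (w * (inverse w * z))) at_infinity (at (w * a))"
    unfolding is_pole_def
    by (rule filterlim_compose) (use filterlim_mult_at[of "inverse w" "w * a"] assms(2) in \<open>simp add: field_simps\<close>)
  moreover have "(\<lambda>z. f (w * (inverse w * z))) = f"
    using assms(2) by (simp flip: mult.assoc)
  ultimately show ?thesis by (simp add: is_pole_def)
qed

text \<open>The residue is the limit of (z - a) f(z); replacing z by w z brings a factor w from the
  difference and \<mu> from f.\<close>

lemma equivariant_residue:
  assumes "w \<noteq> 0" "eventually (\<lambda>z. f (w * z) = \<mu> * f z) (at a)"
    and "((\<lambda>z. f z - c / (z - a)) \<longlongrightarrow> l) (at a)" "((\<lambda>z. f z - c' / (z - w * a)) \<longlongrightarrow> l') (at (w * a :: complex))"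
  shows "c' = w * \<mu> * c"
proof -
  have "((\<lambda>z. (w * z - w * a) * f (w * z)) \<longlongrightarrow> c') (at a)"
    by (rule filterlim_compose[OF tendsto_mult_principal_part[OF assms(4)] filterlim_mult_at[OF assms(1)]])
  moreover have "eventually (\<lambda>z. (w * z - w * a) * f (w * z) = w * \<mu> * ((z - a) * f z)) (at a)"
    using assms(2) by eventually_elim (simp add: algebra_simps)
  ultimately have "((\<lambda>z. w * \<mu> * ((z - a) * f z)) \<longlongrightarrow> c') (at a)"
    by (rule Lim_transform_eventually)
  moreover have "((\<lambda>z. w * \<mu> * ((z - a) * f z)) \<longlongrightarrow> w * \<mu> * c) (at a)"
    by (intro tendsto_intros tendsto_mult_principal_part[OF assms(3)])
  ultimately show ?thesis by (rule tendsto_unique[OF trivial_limit_at])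
qed

text \<open>The comparison element that bounds the number of poles of a simple element by 3. Its
  poles have modulus 1 and avoid I because r < 1.\<close>

lemma ratio_candidate:
  assumes "0 < r" "r < 1"
  shows "(\<lambda>z. ratio 1 z *\<^sub>M mat 1) \<in> candidate_elements r" (is "?g \<in> _")
    and "poles (\<lambda>z. ratio 1 z *\<^sub>M mat 1) \<subseteq> {z. z ^ 3 = 1 ^ 3}"
proof -
  define p q :: "complex poly" where "p = [:1, 0, 0, 1:]" and "q = [:-1, 0, 0, 1:]"
  have pq: "poly p z = z^3 + 1" "poly q z = z^3 - 1" for z
    by (simp_all add: p_def q_def power3_eq_cube algebra_simps)
  have f: "\<forall>z. poly q z \<noteq> 0 \<longrightarrow> ratio 1 z = poly p z / poly q z"
    by (simp add: pq ratio_def)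
  have "q \<noteq> 0" by (simp add: q_def)
  have "coprime p q"
  proof (rule coprimeI)
    fix d assume "d dvd p" "d dvd q"
    hence "d dvd p - q" by (rule dvd_diff)
    moreover have "p - q = [:2:]" by (simp add: p_def q_def)
    moreover have "is_unit [:2 :: complex:]" by (simp add: is_unit_poly_iff dvd_field_iff)
    ultimately show "is_unit d" by (metis dvd_trans)
  qed
  note pole = rational_pole_iff[OF \<open>q \<noteq> 0\<close> \<open>coprime p q\<close> f]
  have entry: "(\<lambda>z. (ratio 1 z *\<^sub>M mat 1) $ i $ j) = (if i = j then ratio 1 else (\<lambda>_. 0))" for i j :: 3
    by (auto simp: mat_component)
  have nonpole: "z ^ 3 - 1 \<noteq> 0" "z ^ 3 + 1 \<noteq> 0" if "z \<in> I_dom r" for z :: complex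
  proof -
    have "cmod z \<noteq> 1" using that assms by (auto simp: I_dom_def field_simps)
    hence "cmod (z ^ 3) \<noteq> 1"
      using power_eq_imp_eq_base[of "cmod z" 3 1] by (auto simp: norm_power)
    thus "z ^ 3 - 1 \<noteq> 0" "z ^ 3 + 1 \<noteq> 0"
      by (auto simp: eq_neg_iff_add_eq_0[symmetric])
  qed
  show "poles ?g \<subseteq> {z. z ^ 3 = 1 ^ 3}"
    unfolding poles_def entry by (auto split: if_splits simp: pole pq)
  have "?g \<in> loop_group r"
    unfolding loop_group_def mem_Collect_eq
  proof (intro conjI ballI exI[of _ "mat 1"])
    show "matrix_holomorphic_on ?g (I_dom r)"
      unfolding matrix_holomorphic_on_def entry
      using holomorphic_on_subset[OF rational_holomorphic[OF f], of "I_dom r"] nonpole by (auto simp: pq)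
    have inv: "invertible (c *\<^sub>M (mat 1 :: mat3))" and sig: "sigma (c *\<^sub>M mat 1) = inverse c *\<^sub>M mat 1"
      if "c \<noteq> 0" for c
    proof -
      show "invertible (c *\<^sub>M (mat 1 :: mat3))"
        unfolding invertible_def
        by (rule exI[of _ "inverse c *\<^sub>M mat 1"])
           (use that in \<open>simp add: vec_eq_iff forall_3 matrix_mult3 mat_component\<close>)
      show "sigma (c *\<^sub>M mat 1) = inverse c *\<^sub>M mat 1"
        by (rule sigma_eqI) (use that in \<open>simp add: vec_eq_iff forall_3 matrix_mult3 mat_component\<close>)
    qed
    fix z assume z: "z \<in> I_dom r"
    have r0: "ratio 1 z \<noteq> 0" using nonpole[OF z] by (simp add: ratio_def)
    thus "invertible (?g z)" by (rule inv)
    have "(eps * z)^3 = - (z^3)" by (simp add: power_mult_distrib eps_power)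
    hence "ratio 1 (eps * z) = (- (z^3 - 1)) / (- (z^3 + 1))" by (simp add: ratio_def)
    also have "\<dots> = inverse (ratio 1 z)"
      unfolding nonzero_minus_divide_divide[OF nonpole(2)[OF z]] by (simp add: ratio_def)
    finally have "ratio 1 (eps * z) = inverse (ratio 1 z)" .
    thus "sigma (?g z) = ?g (eps * z)" using sig[OF r0] by simp
  next
    show "matrix_holomorphic_on (\<lambda>w. if w = 0 then mat 1 else ?g (1 / w)) (ball 0 r)"
      unfolding matrix_holomorphic_on_def
    proof (intro allI)
      fix i j :: 3
      have n: "1 - w^3 \<noteq> 0" if "w \<in> ball 0 r" for w :: complex
        using nonpole(1)[of w] that ball_subset_I_dom[of r] by auto
      \<comment> \<open>This is the ratio at 1/w; its value 1 at w = 0 explains the identity matrix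
        as value at infinity.\<close>
      have "(\<lambda>w. (1 + w^3) / (1 - w^3) * mat 1 $ i $ j) holomorphic_on ball 0 r"
        by (intro holomorphic_intros) (use n in auto)
      moreover have "(if w = 0 then mat 1 else ?g (1 / w)) $ i $ j = (1 + w^3) / (1 - w^3) * mat 1 $ i $ j"
        if "w \<in> ball 0 r" for w
        using n[OF that] by (auto simp: ratio_def power_divide divide_simps)
      ultimately show "(\<lambda>w. (if w = 0 then mat 1 else ?g (1 / w)) $ i $ j) holomorphic_on ball 0 r"
        by (metis (no_types, lifting) holomorphic_transform)
    qed
    show "invertible (mat 1 :: mat3)" by (simp add: invertible_def)
    show "sigma (mat 1) = mat 1" by (rule sigma_eqI) simp
  qed
  moreover have "rational_matrix ?g"
    unfolding rational_matrix_def
  proof (intro allI)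
    fix i j :: 3
    show "\<exists>p q :: complex poly. q \<noteq> 0 \<and> coprime p q \<and>
       (\<forall>z. poly q z \<noteq> 0 \<longrightarrow> ?g z $ i $ j = poly p z / poly q z)"
    proof (cases "i = j")
      case True
      show ?thesis
        by (intro exI[of _ p] exI[of _ q]) (use True \<open>q \<noteq> 0\<close> \<open>coprime p q\<close> f in \<open>simp add: mat_component\<close>)
    next
      case False
      thus ?thesis by (intro exI[of _ 0] exI[of _ 1]) (simp add: mat_component)
    qed
  qed
  moreover have "only_simple_poles ?g"
    unfolding only_simple_poles_def entry
  proof (intro allI impI)
    fix a :: complex and i j :: 3
    assume a: "is_pole (if i = j then ratio 1 else (\<lambda>_. 0)) a"
    hence "i = j" by (auto split: if_splits)
    with a have a3: "a ^ 3 = 1" by (simp add: pole pq)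
    \<comment> \<open>The polynomial z^2 + a z + a^2 is the cofactor of z - a in z^3 - 1, since a^3
      = 1.\<close>
    let ?S = "{z. poly [:a^2, a, 1:] z \<noteq> 0}"
    have s: "poly [:a^2, a, 1:] z = z^2 + a * z + a^2" for z
      by (simp add: power2_eq_square algebra_simps)
    have "zorder (ratio 1) a = -1"
    proof (rule zorder_eqI)
      show "open ?S" by (rule open_poly_nonzero) simp
      show "a \<in> ?S" using a3 by (auto simp: power2_eq_square)
      show "(\<lambda>z. (z^3 + 1) / poly [:a^2, a, 1:] z) holomorphic_on ?S"
        by (intro holomorphic_intros) auto
      show "(a^3 + 1) / poly [:a^2, a, 1:] a \<noteq> 0"
        using a3 \<open>a \<in> ?S\<close> by simp
      fix w assume "w \<in> ?S" "w \<noteq> a"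
      have "w^3 - 1 = (w^2 + a * w + a^2) * (w - a)"
        using a3 by (simp add: algebra_simps power2_eq_square power3_eq_cube)
      thus "ratio 1 w = (w^3 + 1) / poly [:a^2, a, 1:] w * (w - a) powi -1"
        unfolding s by (simp add: ratio_def power_int_minus field_simps)
    qed
    with \<open>i = j\<close> show "zorder (if i = j then ratio 1 else (\<lambda>_. 0)) a = -1" by simp
  qed
  moreover have "\<not> (\<exists>C. \<forall>z \<in> I_dom r. ?g z = C)"
  proof
    assume "\<exists>C. \<forall>z \<in> I_dom r. ?g z = C"
    \<comment> \<open>The ratio takes the value -1 only where z^3 = 0, so 0 and r/2 tell it apart
      from a constant.\<close>
    moreover have "0 \<in> I_dom r" "of_real (r / 2) \<in> I_dom r" using assms by (auto simp: I_dom_def)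
    ultimately have "?g 0 $ 1 $ 1 = ?g (of_real (r / 2)) $ 1 $ 1" by metis
    hence "ratio 1 (of_real (r / 2)) = -1" by (simp add: mat_component ratio_def)
    hence "(of_real (r / 2) :: complex) ^ 3 = 0"
      using nonpole[OF \<open>of_real (r / 2) \<in> I_dom r\<close>] by (simp add: ratio_def divide_simps)
    with assms show False by simp
  qed
  ultimately show "?g \<in> candidate_elements r" by (simp add: candidate_elements_def)
qed

section \<open>Simple elements\<close>

text \<open>The entry at \<open>(i, j)\<close> is \<open>q\<^sub>j / q\<^sub>i\<close> for \<open>Q = diag(q\<^sub>1, q\<^sub>2, q\<^sub>3)\<close>.\<close>

definition twist_multiplier :: mat3 where
  "twist_multiplier = mat3_of [[1, eps^4, eps^2], [eps^2, 1, eps^4], [eps^4, eps^2, 1]]"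

lemma Qmat_conjugate_component:
  "(matrix_inv Qmat ** X ** Qmat) $ i $ j = twist_multiplier $ i $ j * X $ i $ j"
  "(Qmat ** X ** matrix_inv Qmat) $ i $ j = twist_multiplier $ i $ j ^ 2 * X $ i $ j"
proof -
  have "matrix_inv Qmat ** X ** Qmat = (\<chi> i j. twist_multiplier $ i $ j * X $ i $ j)"
    "Qmat ** X ** matrix_inv Qmat = (\<chi> i j. twist_multiplier $ i $ j ^ 2 * X $ i $ j)"
    unfolding matrix_inv_Qmat unfolding Qmat_def
    by (rule mat3_eqI; simp add: diag3_mult_component twist_multiplier_def eps_power eps_square
          eps_mult_left algebra_simps power2_eq_square)+
  thus "(matrix_inv Qmat ** X ** Qmat) $ i $ j = twist_multiplier $ i $ j * X $ i $ j"
    "(Qmat ** X ** matrix_inv Qmat) $ i $ j = twist_multiplier $ i $ j ^ 2 * X $ i $ j"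
    by simp_all
qed

lemma eps_power_distinct: "eps^2 \<noteq> 1" "eps^4 \<noteq> 1" "eps^2 \<noteq> eps^4"
proof -
  have no: "eps \<noteq> c" if "c^2 \<noteq> c - 1" for c using that eps_square by auto
  show "eps^2 \<noteq> 1" using no[of 2] by (auto simp: eps_square algebra_simps)
  show "eps^4 \<noteq> 1" using no[of "-1"] by (simp add: eps_power) (metis add.inverse_inverse)
  show "eps^2 \<noteq> eps^4"
  proof
    assume "eps^2 = eps^4"
    hence "eps = 1 / 2" by (simp add: eps_square eps_power algebra_simps eq_neg_iff_add_eq_0)
    thus False using no[of "1/2"] by (simp add: power2_eq_square)
  qed
qed

lemma twist_multiplier_nonzero: "twist_multiplier $ i $ j \<noteq> 0"
  and twist_multiplier_off_diagonal: "i \<noteq> j \<Longrightarrow> twist_multiplier $ i $ j \<noteq> 1"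
  using exhaust_3[of i] exhaust_3[of j] eps_power_distinct by (auto simp: twist_multiplier_def)

text \<open>Two steps of the twist, from z to \<epsilon> z to \<epsilon>^2 z, amount to conjugation
  by Q, which acts on each entry separately.\<close>

lemma loop_group_rotation:
  assumes "g \<in> loop_group r" "z \<in> I_dom r"
  shows "g (eps^2 * z) $ i $ j = twist_multiplier $ i $ j * g z $ i $ j"
proof -
  have "g (eps * (eps * z)) ** Pmat ** transpose (g (eps * z)) = Pmat"
    by (intro loop_group_twist[OF assms(1)] eps_mult_I_dom assms(2))
  from sigma_twice[OF loop_group_twist[OF assms] this]
  have "g (eps^2 * z) = matrix_inv Qmat ** g z ** Qmat"
    by (simp add: matrix_inv_Qmat power2_eq_square mult.assoc)
  thus ?thesis by (simp add: Qmat_conjugate_component)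
qed

text \<open>A fixed point of the twist is fixed by its square, hence commutes with Q, whose
  eigenvalues are distinct.\<close>

lemma sigma_fixed_imp_diagonal:
  assumes "invertible L" "sigma L = L"
  shows "is_diagonal L"
proof -
  have "L ** Pmat ** transpose L = Pmat" using assms by (rule sigma_eq_imp)
  from sigma_twice[OF this this] have "L = matrix_inv Qmat ** L ** Qmat"
    by (simp add: matrix_inv_Qmat)
  hence "L $ i $ j = twist_multiplier $ i $ j * L $ i $ j" for i j
    by (metis Qmat_conjugate_component(1))
  thus ?thesis
    unfolding is_diagonal_def using twist_multiplier_off_diagonal by (metis mult_cancel_right1 mult.commute)
qed

lemma simple_element_has_simple_form:
  assumes r: "0 < r" "r < 1" and simple: "simple_element r g"
  shows "\<exists>\<alpha> A R. r \<le> cmod \<alpha> \<and> cmod \<alpha> \<le> 1 / r \<and>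
           poles g = {\<alpha>, eps ^ 2 * \<alpha>, eps ^ 4 * \<alpha>} \<and> has_simple_form g \<alpha> A R"
proof -
  have g: "g \<in> loop_group r" and rat: "rational_matrix g" and simp: "only_simple_poles g"
    and nonconst: "\<not> (\<exists>C. \<forall>z \<in> I_dom r. g z = C)"
    using simple by (auto simp: simple_element_def candidate_elements_def)
  define K where "K = poles g"
  let ?w = "eps^2" and ?\<mu> = "\<lambda>i j. twist_multiplier $ i $ j"
  have "\<forall>i j. \<exists>q. q \<noteq> 0 \<and> (\<forall>a. is_pole (\<lambda>z. g z $ i $ j) a \<longleftrightarrow> poly q a = 0) \<and>
      (\<lambda>z. g z $ i $ j) holomorphic_on {z. poly q z \<noteq> 0}"
  proof (intro allI)
    fix i j
    obtain p q :: "complex poly" where "q \<noteq> 0" "coprime p q"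
      and f: "\<forall>z. poly q z \<noteq> 0 \<longrightarrow> g z $ i $ j = poly p z / poly q z"
      using rat unfolding rational_matrix_def by blast
    from rational_pole_iff[OF this] rational_holomorphic[OF f] \<open>q \<noteq> 0\<close>
    show "\<exists>q. q \<noteq> 0 \<and> (\<forall>a. is_pole (\<lambda>z. g z $ i $ j) a \<longleftrightarrow> poly q a = 0) \<and>
      (\<lambda>z. g z $ i $ j) holomorphic_on {z. poly q z \<noteq> 0}"
      by (intro exI[of _ q] conjI allI)
  qed
  then obtain q where q: "\<And>i j. q i j \<noteq> 0"
    and pole: "\<And>i j a. is_pole (\<lambda>z. g z $ i $ j) a \<longleftrightarrow> poly (q i j) a = 0"
    and hol: "\<And>i j. (\<lambda>z. g z $ i $ j) holomorphic_on {z. poly (q i j) z \<noteq> 0}"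
    by metis
  have "K = (\<Union>i. \<Union>j. {a. poly (q i j) a = 0})"
    by (auto simp: K_def poles_def pole)
  hence K: "finite K" using q by (simp add: poly_roots_finite)
  have holK: "(\<lambda>z. g z $ i $ j) holomorphic_on - K" for i j
    by (rule holomorphic_on_subset[OF hol]) (auto simp: K_def poles_def pole)
  have KI: "a \<notin> I_dom r" if "a \<in> K" for a
  proof
    assume "a \<in> I_dom r"
    hence "\<not> is_pole (\<lambda>z. g z $ i $ j) a" for i j
      using g by (intro not_is_pole_holomorphic[OF open_I_dom])
        (auto simp: loop_group_def matrix_holomorphic_on_def)
    with that show False by (auto simp: K_def poles_def)
  qed
  obtain L where L: "invertible L" "sigma L = L" and lim: "((\<lambda>z. g z $ i $ j) \<longlongrightarrow> L $ i $ j) at_infinity" for i j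
    using loop_group_limit_at_infinity[OF g r(1)] by blast
  \<comment> \<open>A point of K may be a pole of another entry only; where the entry itself is
    regular, the coefficient 0 serves.\<close>
  have pp_ex: "\<exists>c l. ((\<lambda>z. g z $ i $ j - c / (z - a)) \<longlongrightarrow> l) (at a)" if "a \<in> K" for a i j
  proof (cases "is_pole (\<lambda>z. g z $ i $ j) a")
    case True
    have op: "open (- (K - {a}))" using K by (intro open_Compl finite_imp_closed) simp
    have ho: "(\<lambda>z. g z $ i $ j) holomorphic_on - (K - {a}) - {a}"
      by (rule holomorphic_on_subset[OF holK]) auto
    have zo: "zorder (\<lambda>z. g z $ i $ j) a = -1"
      using simp True unfolding only_simple_poles_def by blast
    show ?thesis
      by (rule simple_pole_principal_part[OF op _ ho True zo]) auto
  next
    case False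
    hence "a \<in> {z. poly (q i j) z \<noteq> 0}" by (simp add: pole)
    hence "isCont (\<lambda>z. g z $ i $ j) a"
      using holomorphic_on_imp_continuous_on[OF hol] open_poly_nonzero[OF q]
      by (simp add: continuous_on_eq_continuous_at)
    hence "((\<lambda>z. g z $ i $ j - 0 / (z - a)) \<longlongrightarrow> g a $ i $ j) (at a)" by (simp add: isCont_def)
    thus ?thesis by blast
  qed
  define c where "c = (\<lambda>i j a. SOME c. \<exists>l. ((\<lambda>z. g z $ i $ j - c / (z - a)) \<longlongrightarrow> l) (at a))"
  have pp: "\<exists>l. ((\<lambda>z. g z $ i $ j - c i j a / (z - a)) \<longlongrightarrow> l) (at a)" if "a \<in> K" for i j a
    unfolding c_def by (rule someI_ex) (rule pp_ex[OF that])
  have pf: "g z $ i $ j = L $ i $ j + (\<Sum>a\<in>K. c i j a / (z - a))" if "z \<notin> K" for z i j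
    using K holK pp lim that by (rule partial_fractions)
  have rot: "eventually (\<lambda>z. g (?w * z) $ i $ j = ?\<mu> i j * g z $ i $ j) (at a)" for a i j
  proof -
    \<comment> \<open>The points where z or \<epsilon>^2 z is a pole. The complement of this finite
      set is connected and contains the disc around 0, on which the rotation rule is known.\<close>
    define K' where "K' = K \<union> (\<lambda>a. inverse ?w * a) ` K"
    have K': "finite K'" using K by (simp add: K'_def)
    have mem: "z \<notin> K \<and> ?w * z \<notin> K" if "z \<notin> K'" for z
    proof -
      have "inverse ?w * (?w * z) = z" by (simp flip: mult.assoc)
      thus ?thesis using that unfolding K'_def by (metis Un_iff image_eqI)
    qed
    have "g (?w * z) $ i $ j = ?\<mu> i j * g z $ i $ j" if "z \<in> - K'" for z
    proof (rule analytic_continuation_open[of "ball 0 r" "- K'" "\<lambda>z. g (?w * z) $ i $ j"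
          "\<lambda>z. ?\<mu> i j * g z $ i $ j"])
      show "open (- K')" using K' by (intro open_Compl finite_imp_closed)
      show "connected (- K')"
        using K' by (intro path_connected_imp_connected path_connected_complement_countable countable_finite) auto
      show "ball 0 r \<subseteq> - K'"
      proof
        fix z assume z: "z \<in> ball (0::complex) r"
        show "z \<in> - K'"
        proof
          assume "z \<in> K'"
          then obtain a where "a \<in> K" "cmod a = cmod z"
            by (auto simp: K'_def norm_mult norm_power norm_inverse)
          with KI[of a] z show False by (simp add: I_dom_def)
        qed
      qed
      show "(\<lambda>z. ?\<mu> i j * g z $ i $ j) holomorphic_on - K'"
        using mem by (intro holomorphic_intros holomorphic_on_subset[OF holK]) auto
      have "((\<lambda>z. g z $ i $ j) \<circ> (\<lambda>z. ?w * z)) holomorphic_on - K'"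
        by (rule holomorphic_on_compose_gen[OF _ holK]) (use mem in \<open>auto intro!: holomorphic_intros\<close>)
      thus "(\<lambda>z. g (?w * z) $ i $ j) holomorphic_on - K'" by (simp add: o_def)
      show "g (?w * z) $ i $ j = ?\<mu> i j * g z $ i $ j" if "z \<in> ball 0 r" for z
        using that ball_subset_I_dom by (intro loop_group_rotation[OF g]) blast
    qed (use r that in auto)
    thus ?thesis
      using eventually_notin_finite[OF K', of a] by (auto elim!: eventually_mono)
  qed
  have K_rot: "?w * a \<in> K" if "a \<in> K" for a
  proof -
    from that obtain i j where "is_pole (\<lambda>z. g z $ i $ j) a" by (auto simp: K_def poles_def)
    from equivariant_pole[OF twist_multiplier_nonzero _ rot this] show ?thesis
      by (auto simp: K_def poles_def)
  qed
  \<comment> \<open>Without poles the partial fraction expansion reduces to the constant L.\<close>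
  have "K \<noteq> {}"
  proof
    assume "K = {}"
    hence "\<forall>z \<in> I_dom r. g z = L" using pf by (simp add: vec_eq_iff)
    with nonconst show False by blast
  qed
  then obtain \<alpha> where "\<alpha> \<in> K" by blast
  define Orb where "Orb = {\<alpha>, ?w * \<alpha>, eps^4 * \<alpha>}"
  have w2: "?w * (?w * \<alpha>) = eps^4 * \<alpha>" by (simp flip: mult.assoc power_add)
  have "Orb \<subseteq> K"
    using \<open>\<alpha> \<in> K\<close> K_rot[OF \<open>\<alpha> \<in> K\<close>] K_rot[OF K_rot[OF \<open>\<alpha> \<in> K\<close>]] by (simp add: Orb_def w2)
  have "\<alpha> \<noteq> 0" using KI[OF \<open>\<alpha> \<in> K\<close>] r by (auto simp: I_dom_def)
  hence distinct: "\<alpha> \<noteq> ?w * \<alpha>" "\<alpha> \<noteq> eps^4 * \<alpha>" "?w * \<alpha> \<noteq> eps^4 * \<alpha>"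
    using eps_power_distinct by simp_all
  hence "card Orb = 3" by (simp add: Orb_def)
  \<comment> \<open>Minimality enters here: the comparison element has at most three poles, and the
    orbit of \<alpha> already accounts for three in K.\<close>
  have "card K \<le> card (poles (\<lambda>z. ratio 1 z *\<^sub>M mat 1))"
    using simple ratio_candidate(1)[OF r] by (auto simp: simple_element_def K_def)
  also have "\<dots> \<le> card {z. z ^ 3 = (1 :: complex) ^ 3}"
    by (rule card_mono[OF finite_cube_roots ratio_candidate(2)[OF r]])
  also have "\<dots> \<le> 3"
  proof -
    have "{z. z ^ 3 = (1 :: complex) ^ 3} = {1, eps^2, eps^4}"
      using cube_eq_iff[of _ 1] by auto
    thus ?thesis using eps_power_distinct by simp
  qed
  finally have "card K \<le> card Orb" unfolding \<open>card Orb = 3\<close> .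
  from card_seteq[OF K \<open>Orb \<subseteq> K\<close> this] have "K = Orb" ..
  have res: "c i j (?w * a) = ?w * ?\<mu> i j * c i j a" if a: "a \<in> K" for a i j
  proof -
    from pp[OF a, of i j] obtain l
      where l: "((\<lambda>z. g z $ i $ j - c i j a / (z - a)) \<longlongrightarrow> l) (at a)" ..
    from pp[OF K_rot[OF a], of i j] obtain l'
      where l': "((\<lambda>z. g z $ i $ j - c i j (?w * a) / (z - ?w * a)) \<longlongrightarrow> l') (at (?w * a))" ..
    show ?thesis by (rule equivariant_residue[OF _ rot l l']) simp
  qed
  have diag: "is_diagonal L" using L by (rule sigma_fixed_imp_diagonal)
  have L_ne: "L $ i $ i \<noteq> 0" for i
  proof -
    obtain d s where "d \<noteq> 0" "s = 1 \<or> s = -1" "L = diag3 d (inverse d) s"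
      using diagonal_fixed_by_sigma[OF diag sigma_eq_imp[OF L]] by blast
    thus ?thesis using exhaust_3[of i] by auto
  qed
  \<comment> \<open>In the simple form L stands to the left of the bracket, so the residue of g at
    \<alpha> is L R and has to be divided by L row by row.\<close>
  define R :: mat3 where "R = (\<chi> i j. c i j \<alpha> / L $ i $ i)"
  have LR: "L $ i $ i * R $ i $ j = c i j \<alpha>" for i j using L_ne by (simp add: R_def)
  have L_mult: "(L ** X) $ i $ j = L $ i $ i * X $ i $ j" for X :: mat3 and i j
    using diag exhaust_3[of i] by (auto simp: matrix_mult3 is_diagonal_def)
  have "has_simple_form g \<alpha> L R"
    unfolding has_simple_form_def
  proof (intro conjI allI impI diag)
    fix z assume z: "z \<notin> {\<alpha>, ?w * \<alpha>, eps^4 * \<alpha>}"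
    show "g z = L ** (mat 1 + (1 / (z - \<alpha>)) *\<^sub>M R
          + (?w / (z - ?w * \<alpha>)) *\<^sub>M (matrix_inv Qmat ** R ** Qmat)
          + (eps ^ 4 / (z - eps ^ 4 * \<alpha>)) *\<^sub>M (Qmat ** R ** matrix_inv Qmat))"
      unfolding vec_eq_iff
    proof (intro allI)
      fix i j
      \<comment> \<open>The factor \<epsilon>^2 is the scalar in front of the conjugated matrix in
        the simple form, and the multiplier is the conjugation itself; a second rotation squares
        both.\<close>
      have c1: "c i j (?w * \<alpha>) = ?w * ?\<mu> i j * c i j \<alpha>"
        by (rule res[OF \<open>\<alpha> \<in> K\<close>])
      have "c i j (eps^4 * \<alpha>) = ?w * ?\<mu> i j * (?w * ?\<mu> i j * c i j \<alpha>)"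
        using res[OF K_rot[OF \<open>\<alpha> \<in> K\<close>], of i j] unfolding w2 c1 .
      also have "\<dots> = (?w * ?w) * ?\<mu> i j ^ 2 * c i j \<alpha>"
        by (simp only: power2_eq_square[of "?\<mu> i j"] mult_ac)
      also have "?w * ?w = eps^4" by (simp flip: power_add)
      finally have c2: "c i j (eps^4 * \<alpha>) = eps^4 * ?\<mu> i j ^ 2 * c i j \<alpha>" .
      note c = c1[folded LR] c2[folded LR]
      have "g z $ i $ j = L $ i $ j + (c i j \<alpha> / (z - \<alpha>) + c i j (?w * \<alpha>) / (z - ?w * \<alpha>)
          + c i j (eps^4 * \<alpha>) / (z - eps^4 * \<alpha>))"
        using pf[of z i j] z distinct by (simp add: \<open>K = Orb\<close> Orb_def add.assoc)
      also have "\<dots> = L $ i $ i * (mat 1 $ i $ j + (1 / (z - \<alpha>)) * R $ i $ j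
          + (?w / (z - ?w * \<alpha>)) * (?\<mu> i j * R $ i $ j) + (eps ^ 4 / (z - eps ^ 4 * \<alpha>)) * (?\<mu> i j ^ 2 * R $ i $ j))"
      proof -
        have "L $ i $ j = L $ i $ i * mat 1 $ i $ j"
          using diag by (simp add: is_diagonal_def mat_component)
        thus ?thesis unfolding c LR[symmetric, of i j] by (simp add: distrib_left mult_ac)
      qed
      finally show "g z $ i $ j = (L ** (mat 1 + (1 / (z - \<alpha>)) *\<^sub>M R
          + (?w / (z - ?w * \<alpha>)) *\<^sub>M (matrix_inv Qmat ** R ** Qmat)
          + (eps ^ 4 / (z - eps ^ 4 * \<alpha>)) *\<^sub>M (Qmat ** R ** matrix_inv Qmat))) $ i $ j"
        unfolding L_mult vector_add_component cscale_component Qmat_conjugate_component .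
    qed
  qed
  moreover have "r \<le> cmod \<alpha>" "cmod \<alpha> \<le> 1 / r"
    using KI[OF \<open>\<alpha> \<in> K\<close>] by (auto simp: I_dom_def)
  moreover have "poles g = {\<alpha>, ?w * \<alpha>, eps^4 * \<alpha>}"
    using \<open>K = Orb\<close> by (simp add: K_def Orb_def)
  ultimately show ?thesis by blast
qed

lemma is_diagonal_diag3: "is_diagonal (diag3 a b c)"
  unfolding is_diagonal_def
proof (intro allI impI)
  fix i j :: 3
  assume "i \<noteq> j"
  thus "diag3 a b c $ i $ j = 0" using exhaust_3[of i] exhaust_3[of j] by (elim disjE) simp_all
qed

text \<open>The scalar elements account for the alternative of rank 3, and det A = s for the sign in
  the determinants. The relation between the families is stated away from z^3 = -\<alpha>^3, where g
  at -z has its poles. The bounds on the modulus of \<alpha> are not strict, since I is open and a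
  pole may lie on a boundary circle.\<close>

theorem proposition4p2:
  fixes r :: real
  assumes "0 < r" and "r < 1"
  shows
    "(\<forall>g. simple_element r g \<longrightarrow>
        (\<exists>\<alpha> A R. r \<le> cmod \<alpha> \<and> cmod \<alpha> \<le> 1 / r \<and>
           poles g = {\<alpha>, eps ^ 2 * \<alpha>, eps ^ 4 * \<alpha>} \<and> has_simple_form g \<alpha> A R) \<and>
        (\<forall>\<alpha> A R. has_simple_form g \<alpha> A R \<longrightarrow>
           (\<exists>d s. d \<noteq> 0 \<and> (s = 1 \<or> s = -1) \<and> A = diag3 d (inverse d) s) \<and>
           ((rank R = 1 \<and> (\<exists>l. admissible_line l \<and>
                (\<forall>z. z ^ 3 \<noteq> \<alpha> ^ 3 \<longrightarrow> g z = A ** g_elt \<alpha> l z))) \<or>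
            (rank R = 2 \<and> (\<exists>l. admissible_line l \<and>
                (\<forall>z. z ^ 3 \<noteq> \<alpha> ^ 3 \<longrightarrow> g z = A ** m_elt \<alpha> l z))) \<or>
            (rank R = 3 \<and>
                (\<forall>z. z ^ 3 \<noteq> \<alpha> ^ 3 \<longrightarrow> g z = ratio \<alpha> z *\<^sub>M A)))))
     \<and>
     (\<forall>\<alpha> l d s. \<forall>A. \<alpha> \<noteq> 0 \<longrightarrow> admissible_line l \<longrightarrow> d \<noteq> 0 \<longrightarrow> s = 1 \<or> s = -1 \<longrightarrow>
        A = diag3 d (inverse d) s \<longrightarrow>
        (\<exists>R. has_simple_form (\<lambda>z. A ** g_elt \<alpha> l z) \<alpha> A R \<and> rank R = 1 \<and>
           (\<forall>z. z ^ 3 \<noteq> \<alpha> ^ 3 \<longrightarrow> det (A ** g_elt \<alpha> l z) = s * ratio \<alpha> z ^ rank R)) \<and>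
        (\<exists>R. has_simple_form (\<lambda>z. A ** m_elt \<alpha> l z) \<alpha> A R \<and> rank R = 2 \<and>
           (\<forall>z. z ^ 3 \<noteq> \<alpha> ^ 3 \<longrightarrow> det (A ** m_elt \<alpha> l z) = s * ratio \<alpha> z ^ rank R)) \<and>
        (\<forall>z. z ^ 3 \<noteq> \<alpha> ^ 3 \<longrightarrow> z ^ 3 \<noteq> - (\<alpha> ^ 3) \<longrightarrow>
           A ** m_elt \<alpha> l z = ratio \<alpha> z *\<^sub>M (A ** g_elt \<alpha> l (- z))) \<and>
        admissible_line (line_times l (matrix_inv A)) \<and>
        (\<forall>z. z ^ 3 \<noteq> \<alpha> ^ 3 \<longrightarrow>
           A ** g_elt \<alpha> l z = g_elt \<alpha> (line_times l (matrix_inv A)) z ** A))"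
    (is "?classification \<and> ?properties")
proof
  show ?classification
  proof (intro allI impI, rule conjI)
    fix g assume simple: "simple_element r g"
    show "\<exists>\<alpha> A R. r \<le> cmod \<alpha> \<and> cmod \<alpha> \<le> 1 / r \<and>
           poles g = {\<alpha>, eps ^ 2 * \<alpha>, eps ^ 4 * \<alpha>} \<and> has_simple_form g \<alpha> A R"
      using simple_element_has_simple_form[OF assms simple] .
  next
    fix g assume "simple_element r g"
    hence "g \<in> loop_group r" "\<not> (\<exists>C. \<forall>z \<in> I_dom r. g z = C)"
      by (simp_all add: simple_element_def candidate_elements_def)
    note form = simple_form_structure[OF this(1) assms(1) _ this(2)]
    show "\<forall>\<alpha> A R. has_simple_form g \<alpha> A R \<longrightarrow>
           (\<exists>d s. d \<noteq> 0 \<and> (s = 1 \<or> s = -1) \<and> A = diag3 d (inverse d) s) \<and>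
           ((rank R = 1 \<and> (\<exists>l. admissible_line l \<and>
                (\<forall>z. z ^ 3 \<noteq> \<alpha> ^ 3 \<longrightarrow> g z = A ** g_elt \<alpha> l z))) \<or>
            (rank R = 2 \<and> (\<exists>l. admissible_line l \<and>
                (\<forall>z. z ^ 3 \<noteq> \<alpha> ^ 3 \<longrightarrow> g z = A ** m_elt \<alpha> l z))) \<or>
            (rank R = 3 \<and>
                (\<forall>z. z ^ 3 \<noteq> \<alpha> ^ 3 \<longrightarrow> g z = ratio \<alpha> z *\<^sub>M A)))"
      by (intro allI impI) (rule form)
  qed
  show ?properties
  proof (intro allI impI)
    fix \<alpha> d s :: complex and l A
    assume \<alpha>: "\<alpha> \<noteq> 0" and "admissible_line l" and d: "d \<noteq> 0" and s: "s = 1 \<or> s = -1"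
      and A: "A = diag3 d (inverse d) s"
    then obtain b c where l: "l = line_of b c" and bc: "2 * b * c \<noteq> 1"
      unfolding admissible_line_def by blast
    have k: "2 * \<alpha> / 3 \<noteq> 0" using \<alpha> by simp
    have detA: "det A = s" using d by (simp add: A det_3)
    have diag: "is_diagonal A" unfolding A by (rule is_diagonal_diag3)
    have line: "line_times l (matrix_inv A) = line_of (s * b / d) (s * c * d)"
      unfolding l A using d s by (rule line_times_inv_diag3)
    have "2 * (s * b / d) * (s * c * d) = 2 * b * c" using d s by auto
    with bc have "2 * (s * b / d) * (s * c * d) \<noteq> 1" by simp
    hence adm: "admissible_line (line_times l (matrix_inv A))"
      unfolding line admissible_line_def by (intro exI conjI) (rule refl)
    have forms: "has_simple_form (\<lambda>z. A ** g_elt \<alpha> l z) \<alpha> A ((2 * \<alpha> / 3) *\<^sub>M g_residue b c)"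
      "has_simple_form (\<lambda>z. A ** m_elt \<alpha> l z) \<alpha> A ((2 * \<alpha> / 3) *\<^sub>M m_residue b c)"
      using diag by (simp_all add: has_simple_form_iff l g_elt_eq m_elt_eq)
    note ranks = rank_g_residue[OF k, of b c] rank_m_residue[OF k bc]
    have dets: "det (A ** g_elt \<alpha> l z) = s * ratio \<alpha> z ^ 1"
      "det (A ** m_elt \<alpha> l z) = s * ratio \<alpha> z ^ 2" if "z ^ 3 \<noteq> \<alpha> ^ 3" for z
      using det_g_elt[OF that bc] det_m_elt[OF that bc] by (simp_all add: det_mul detA l)
    have mg: "A ** m_elt \<alpha> l z = ratio \<alpha> z *\<^sub>M (A ** g_elt \<alpha> l (- z))"
      if "z ^ 3 \<noteq> \<alpha> ^ 3" "z ^ 3 \<noteq> - (\<alpha> ^ 3)" for z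
      unfolding l m_elt_eq_ratio_g_elt[OF that bc]
      by (simp add: vec_eq_iff matrix_mult3 algebra_simps)
    have conj: "A ** g_elt \<alpha> l z = g_elt \<alpha> (line_times l (matrix_inv A)) z ** A" for z
      unfolding line unfolding l A using d s by (rule g_elt_conjugate)
    show "(\<exists>R. has_simple_form (\<lambda>z. A ** g_elt \<alpha> l z) \<alpha> A R \<and> rank R = 1 \<and>
           (\<forall>z. z ^ 3 \<noteq> \<alpha> ^ 3 \<longrightarrow> det (A ** g_elt \<alpha> l z) = s * ratio \<alpha> z ^ rank R)) \<and>
        (\<exists>R. has_simple_form (\<lambda>z. A ** m_elt \<alpha> l z) \<alpha> A R \<and> rank R = 2 \<and>
           (\<forall>z. z ^ 3 \<noteq> \<alpha> ^ 3 \<longrightarrow> det (A ** m_elt \<alpha> l z) = s * ratio \<alpha> z ^ rank R)) \<and>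
        (\<forall>z. z ^ 3 \<noteq> \<alpha> ^ 3 \<longrightarrow> z ^ 3 \<noteq> - (\<alpha> ^ 3) \<longrightarrow>
           A ** m_elt \<alpha> l z = ratio \<alpha> z *\<^sub>M (A ** g_elt \<alpha> l (- z))) \<and>
        admissible_line (line_times l (matrix_inv A)) \<and>
        (\<forall>z. z ^ 3 \<noteq> \<alpha> ^ 3 \<longrightarrow>
           A ** g_elt \<alpha> l z = g_elt \<alpha> (line_times l (matrix_inv A)) z ** A)"
      by (intro conjI exI[of _ "(2 * \<alpha> / 3) *\<^sub>M g_residue b c"]
           exI[of _ "(2 * \<alpha> / 3) *\<^sub>M m_residue b c"]
           allI impI forms ranks adm mg conj;
          (assumption | (unfold ranks, rule dets, assumption)))
  qed
qed

end
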